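(* There is a numerical constant $c>0$ such that the following holds. Let $(\Omega_i, \mathcal{A}_i, \mu_i)$, $i=1,\ldots,n$, be probability spaces, and denote by $(\Omega, \mathcal{A}, \mu) := \otimes_{i=1}^n (\Omega_i, \mathcal{A}_i, \mu_i)$ their product. Let $f \colon \Omega \to \mathbb{R}$ be a bounded measurable function whose Hoeffding decomposition with respect to $\mu$ is given by $f = \sum_{k=2}^{n} f_k$. Assume that $$\lVert \mathfrak{d}^{(2)} f \rVert_{\mathrm{HS}} \le B_1 \qquad\text{and}\qquad \max_{i=1,\ldots,n}|\mathfrak{d}_i f| \le B_2$$ for some $B_1, B_2 \ge 0$. Then $$\int \exp\Big(\frac{c}{B_1+B_2}|f|\Big) d\mu \le 2.$$ A possible choice is $c = 1/11$. If all the underlying measures $\mu_i$ are two-point measures, one can take $c = 1/7$.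
   Context: Let $(\Omega,\mathcal A,\mu)=\otimes_{i=1}^n(\Omega_i,\mathcal A_i,\mu_i)$ be a product of probability spaces. For $f\in L^2(\mu)$ and $i=1,\ldots,n$ set $$\mathfrak{d}_i f(x) := \Big(\tfrac12\int_{\Omega_i}(f(x)-f(x_1,\ldots,x_{i-1},y_i,x_{i+1},\ldots,x_n))^2\mu_i(dy_i)\Big)^{1/2}.$$ For $i\neq j$ set $$\mathfrak{d}_{ij}f(x):=\Big(\tfrac14\int_{\Omega_i}\int_{\Omega_j}\big(f(x)-f(\ldots,y_i,\ldots)-f(\ldots,y_j,\ldots)+f(\ldots,y_i,\ldots,y_j,\ldots)\big)^2\mu_i(dy_i)\mu_j(dy_j)\Big)^{1/2},$$ where in the arguments the indicated coordinates $x_i$ and/or $x_j$ of $x$ are replaced by $y_i$ and/or $y_j$ and the other coordinates of $x$ are kept. $\mathfrak{d}^{(2)}f$ is the $n\times n$ matrix with entries $\mathfrak{d}_{ij}f$ for $i\ne j$ and $0$ on the diagonal. $\lVert A\rVert_{\mathrm{HS}}=(\sum_{i,j}|a_{ij}|^2)^{1/2}$. The two bounds in the hypotheses are pointwise on $\Omega$. Hoeffding decomposition: every $f\in L^1(\mu)$ has a unique decomposition $f=f_0+f_1+\ldots+f_n$ with $f_0=\int f\,d\mu$ and $f_k(x)=\sum_{i_1<\ldots<i_k}h_{i_1\ldots i_k}(x_{i_1},\ldots,x_{i_k})$ such that $\int h_{i_1\ldots i_k}(x_{i_1},\ldots,x_{i_k})\,\mu_{i_j}(dx_{i_j})=0$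 for all $k=1,\ldots,n$, all $i_1<\ldots<i_k$ and all $j\in\{1,\ldots,k\}$. The hypothesis $f=\sum_{k=2}^nf_k$ means $f_0=0$ and $f_1=0$. *)

theory Defs
  imports "HOL-Probability.Probability"
begin

text \<open>
  A point of the product space is an extensional function on \<open>{1..n}\<close>, i.e. an element of
  \<open>space (Pi\<^sub>M {1..n} M)\<close>; \<open>x(i := y)\<close> replaces its \<open>i\<close>-th coordinate.
\<close>

definition diff1 :: "(nat \<Rightarrow> 'a measure) \<Rightarrow> ((nat \<Rightarrow> 'a) \<Rightarrow> real) \<Rightarrow> nat \<Rightarrow> (nat \<Rightarrow> 'a) \<Rightarrow> real" where
  "diff1 M f i x = sqrt (1/2 * (\<integral>y. (f x - f (x(i := y)))\<^sup>2 \<partial>M i))"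

definition diff2 ::
  "(nat \<Rightarrow> 'a measure) \<Rightarrow> ((nat \<Rightarrow> 'a) \<Rightarrow> real) \<Rightarrow> nat \<Rightarrow> nat \<Rightarrow> (nat \<Rightarrow> 'a) \<Rightarrow> real" where
  "diff2 M f i j x = sqrt (1/4 * (\<integral>y. (\<integral>z.
      (f x - f (x(i := y)) - f (x(j := z)) + f (x(i := y, j := z)))\<^sup>2 \<partial>M j) \<partial>M i))"

definition diff2_matrix ::
  "(nat \<Rightarrow> 'a measure) \<Rightarrow> ((nat \<Rightarrow> 'a) \<Rightarrow> real) \<Rightarrow> (nat \<Rightarrow> 'a) \<Rightarrow> nat \<Rightarrow> nat \<Rightarrow> real" where
  "diff2_matrix M f x i j = (if i = j then 0 else diff2 M f i j x)"

definition hs_norm :: "nat \<Rightarrow> (nat \<Rightarrow> nat \<Rightarrow> real) \<Rightarrow> real" where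
  "hs_norm n A = sqrt (\<Sum>i\<in>{1..n}. \<Sum>j\<in>{1..n}. \<bar>A i j\<bar>\<^sup>2)"

text \<open>
  The kernels \<open>h\<close> are indexed by the sets \<open>I = {i\<^sub>1 < \<dots> < i\<^sub>k}\<close>, and \<open>h I\<close> is a function on
  \<open>Pi\<^sub>M I M\<close>. The one for the empty set is a constant.
\<close>

definition hoeffding_term ::
  "nat \<Rightarrow> (nat set \<Rightarrow> (nat \<Rightarrow> 'a) \<Rightarrow> real) \<Rightarrow> nat \<Rightarrow> (nat \<Rightarrow> 'a) \<Rightarrow> real" where
  "hoeffding_term n h k x = (\<Sum>I | I \<subseteq> {1..n} \<and> card I = k. h I (restrict x I))"

text \<open>
  Identities between integrable functions are understood almost everywhere. Integrability of the
  kernels makes almost every section integrable, so that the vanishing of the partial integrals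
  is never due to the convention that the integral of a non-integrable function is 0.
\<close>

definition hoeffding_decomposition ::
  "nat \<Rightarrow> (nat \<Rightarrow> 'a measure) \<Rightarrow> ((nat \<Rightarrow> 'a) \<Rightarrow> real)
    \<Rightarrow> (nat set \<Rightarrow> (nat \<Rightarrow> 'a) \<Rightarrow> real) \<Rightarrow> bool" where
  "hoeffding_decomposition n M f h \<longleftrightarrow>
     (\<forall>I\<subseteq>{1..n}. integrable (Pi\<^sub>M I M) (h I)) \<and>
     (AE x in Pi\<^sub>M {1..n} M. f x = (\<Sum>k=0..n. hoeffding_term n h k x)) \<and>
     (\<forall>x. hoeffding_term n h 0 x = (\<integral>y. f y \<partial>Pi\<^sub>M {1..n} M)) \<and>
     (\<forall>I\<subseteq>{1..n}. \<forall>i\<in>I. AE x in Pi\<^sub>M (I - {i}) M. (\<integral>y. h I (x(i := y)) \<partial>M i) = 0)"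

definition two_point_measure :: "'a measure \<Rightarrow> bool" where
  "two_point_measure N \<longleftrightarrow>
     (\<exists>a\<in>space N. \<exists>b\<in>space N. \<exists>p::real. a \<noteq> b \<and> 0 < p \<and> p < 1 \<and>
        (\<forall>A\<in>sets N. measure N A = p * indicator A a + (1 - p) * indicator A b))"

definition second_order_hypotheses ::
  "nat \<Rightarrow> (nat \<Rightarrow> 'a measure) \<Rightarrow> ((nat \<Rightarrow> 'a) \<Rightarrow> real) \<Rightarrow> real \<Rightarrow> real \<Rightarrow> bool" where
  "second_order_hypotheses n M f B1 B2 \<longleftrightarrow>
     n \<ge> 1 \<and>
     (\<forall>i\<in>{1..n}. prob_space (M i)) \<and>
     f \<in> borel_measurable (Pi\<^sub>M {1..n} M) \<and>
     bounded (f ` space (Pi\<^sub>M {1..n} M)) \<and>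
     (\<exists>h. hoeffding_decomposition n M f h \<and>
        (AE x in Pi\<^sub>M {1..n} M. hoeffding_term n h 0 x = 0) \<and>
        (AE x in Pi\<^sub>M {1..n} M. hoeffding_term n h 1 x = 0)) \<and>
     0 \<le> B1 \<and> 0 \<le> B2 \<and>
     (\<forall>x\<in>space (Pi\<^sub>M {1..n} M). hs_norm n (diff2_matrix M f x) \<le> B1) \<and>
     (\<forall>x\<in>space (Pi\<^sub>M {1..n} M). (MAX i\<in>{1..n}. \<bar>diff1 M f i x\<bar>) \<le> B2)"

end

theory Submission
  imports Defs
begin

text \<open>
  Put \<open>\<sigma> = B1 + B2\<close> and write \<open>|df|\<^sup>2\<close> for the sum of the squares of the \<open>diff1 M f i\<close>. The proof
  bounds exponential moments of \<open>f\<close> by those of \<open>|df|\<^sup>2\<close>, and these by themselves, each time through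
  an entropy inequality that every product of probability measures satisfies. It is carried out with the
  constant \<open>1/7\<close>; a smaller constant only makes the integral smaller.

  Write \<open>Ent(e\<^sup>F) = E(F e\<^sup>F) - E(e\<^sup>F) ln E(e\<^sup>F)\<close>. Subadditivity of entropy and a symmetrisation in the
  resampled coordinate give the modified logarithmic Sobolev inequality (\<open>modified_log_Sobolev\<close>):
  \<open>Ent(e\<^sup>F)\<close> is at most \<open>E(|dF|\<^sup>2 e\<^sup>F)\<close>, and also at most the same expectation with \<open>|dF|\<^sup>2\<close> replaced
  by the sum of the integrals of the squared positive parts of \<open>F(x) - F(x(i := y))\<close>.

  The one-sided form is applied to multiples of \<open>|df|\<^sup>2\<close>. Increments of the vector of first
  differences in the direction \<open>i\<close> are controlled by the second differences, except for its own \<open>i\<close>-th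
  entry, whose decrease is at most its value and hence at most \<open>B2\<close>. Consequently the sum of
  the squared positive increments of \<open>|df|\<^sup>2\<close> is at most \<open>16 \<sigma>\<^sup>2 |df|\<^sup>2\<close>
  (\<open>gradient_sq_self_bounding\<close>), so \<open>|df|\<^sup>2\<close> is self-bounding and has an
  exponential moment determined by its mean. The mean is where the degree of \<open>f\<close> enters: without terms
  of degree 0 and 1, the Efron-Stein inequality can be applied once more to each \<open>f - E\<^sub>j f\<close>,
  conditionally on the \<open>j\<close>-th coordinate, and bounds the mean of \<open>|df|\<^sup>2\<close> by \<open>B1\<^sup>2\<close>
  (\<open>second_order_Efron_Stein\<close>).

  Finally the two-sided form is applied to multiples of \<open>f\<close>. The duality between entropy and exponential
  moments decouples \<open>|df|\<^sup>2\<close> from \<open>e\<^bsup>sf\<^esup>\<close> (\<open>entropy_duality\<close>), and integrating the resulting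
  differential inequality for \<open>s \<mapsto> ln E(e\<^bsup>sf\<^esup>)\<close> (\<open>Herbst\<close>) yields
  \<open>E exp(\<plusminus>f / (5 \<sigma>)) \<le> exp(1/5)\<close>. As \<open>e \<le> 4\<close>, lowering the exponent from \<open>1/5\<close> to \<open>1/7\<close> absorbs the
  factor 2 that the absolute value costs.
\<close>

section \<open>Bounded measurable functions\<close>

text \<open>
  The bound is required everywhere and not just almost everywhere, so that it passes to all sections
  of a function on a product space.
\<close>

definition bdd_measurable :: "'b measure \<Rightarrow> ('b \<Rightarrow> real) \<Rightarrow> bool" where
  "bdd_measurable N g \<longleftrightarrow> g \<in> borel_measurable N \<and> (\<exists>C. \<forall>x\<in>space N. \<bar>g x\<bar> \<le> C)"

named_theorems bm_intros

lemma bdd_measurableI: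
  "g \<in> borel_measurable N \<Longrightarrow> (\<And>x. x \<in> space N \<Longrightarrow> \<bar>g x\<bar> \<le> C) \<Longrightarrow> bdd_measurable N g"
  unfolding bdd_measurable_def by blast

lemma bdd_measurable_borel:
  "bdd_measurable N g \<Longrightarrow> g \<in> borel_measurable N"
  unfolding bdd_measurable_def by blast

lemma bdd_measurable_bound:
  assumes "bdd_measurable N g"
  obtains C where "0 < C" "\<And>x. x \<in> space N \<Longrightarrow> \<bar>g x\<bar> \<le> C"
proof -
  from assms obtain C where C: "\<And>x. x \<in> space N \<Longrightarrow> \<bar>g x\<bar> \<le> C"
    unfolding bdd_measurable_def by blast
  show ?thesis
    by (rule that[of "max C 1"]) (auto intro: order_trans[OF C])
qed

lemma bdd_measurable_const [bm_intros]: "bdd_measurable N (\<lambda>_. c)"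
  by (rule bdd_measurableI[of _ _ "\<bar>c\<bar>"]) auto

lemma bdd_measurable_add [bm_intros]:
  assumes "bdd_measurable N g" "bdd_measurable N h"
  shows "bdd_measurable N (\<lambda>x. g x + h x)"
proof -
  obtain C where "0 < C" "\<And>x. x \<in> space N \<Longrightarrow> \<bar>g x\<bar> \<le> C"
    using bdd_measurable_bound[OF assms(1)] by blast
  moreover obtain D where "0 < D" "\<And>x. x \<in> space N \<Longrightarrow> \<bar>h x\<bar> \<le> D"
    using bdd_measurable_bound[OF assms(2)] by blast
  ultimately have "\<bar>g x + h x\<bar> \<le> C + D" if "x \<in> space N" for x
    using that by (smt (verit))
  then show ?thesis
    by (rule bdd_measurableI[OF borel_measurable_add[OF assms[THEN bdd_measurable_borel]]])
qed

lemma bdd_measurable_mult [bm_intros]: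
  assumes "bdd_measurable N g" "bdd_measurable N h"
  shows "bdd_measurable N (\<lambda>x. g x * h x)"
proof -
  obtain C where "0 < C" "\<And>x. x \<in> space N \<Longrightarrow> \<bar>g x\<bar> \<le> C"
    using bdd_measurable_bound[OF assms(1)] by blast
  moreover obtain D where "0 < D" "\<And>x. x \<in> space N \<Longrightarrow> \<bar>h x\<bar> \<le> D"
    using bdd_measurable_bound[OF assms(2)] by blast
  ultimately have "\<bar>g x * h x\<bar> \<le> C * D" if "x \<in> space N" for x
    unfolding abs_mult using that by (intro mult_mono) auto
  then show ?thesis
    by (rule bdd_measurableI[OF borel_measurable_times[OF assms[THEN bdd_measurable_borel]]])
qed

text \<open>On the compact range interval a continuous function is bounded.\<close>

lemma bdd_measurable_continuous:
  assumes g: "bdd_measurable N g" and k: "continuous_on UNIV k"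
  shows "bdd_measurable N (\<lambda>x. k (g x))"
proof -
  obtain C where "0 < C" and C: "\<And>x. x \<in> space N \<Longrightarrow> \<bar>g x\<bar> \<le> C"
    using bdd_measurable_bound[OF g] by blast
  have "compact (k ` {-C..C})"
    by (intro compact_continuous_image continuous_on_subset[OF k]) auto
  then obtain B where B: "\<And>y. y \<in> {-C..C} \<Longrightarrow> norm (k y) \<le> B"
    by (meson bounded_iff compact_imp_bounded imageI)
  have [measurable]: "k \<in> borel_measurable borel"
    using k by (rule borel_measurable_continuous_onI)
  show ?thesis
  proof (rule bdd_measurableI[of _ _ B])
    show "(\<lambda>x. k (g x)) \<in> borel_measurable N"
      using bdd_measurable_borel[OF g] by measurable
    show "\<bar>k (g x)\<bar> \<le> B" if "x \<in> space N" for x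
      using B[of "g x"] C[OF that] by (auto simp: abs_le_iff)
  qed
qed

lemma bdd_measurable_continuous2:
  fixes k :: "real \<Rightarrow> real \<Rightarrow> real"
  assumes g: "bdd_measurable N g" and h: "bdd_measurable N h"
    and k: "continuous_on UNIV (\<lambda>z. k (fst z) (snd z))"
  shows "bdd_measurable N (\<lambda>x. k (g x) (h x))"
proof -
  obtain C where C: "0 < C" "\<And>x. x \<in> space N \<Longrightarrow> \<bar>g x\<bar> \<le> C"
    using bdd_measurable_bound[OF g] by blast
  obtain D where D: "0 < D" "\<And>x. x \<in> space N \<Longrightarrow> \<bar>h x\<bar> \<le> D"
    using bdd_measurable_bound[OF h] by blast
  have "compact ((\<lambda>z. k (fst z) (snd z)) ` ({-C..C} \<times> {-D..D}))"
    by (intro compact_continuous_image continuous_on_subset[OF k] compact_Times) auto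
  then obtain B where B: "\<And>z. z \<in> {-C..C} \<times> {-D..D} \<Longrightarrow> norm (k (fst z) (snd z)) \<le> B"
    by (meson bounded_iff compact_imp_bounded imageI)
  have [measurable]: "(\<lambda>z. k (fst z) (snd z)) \<in> borel_measurable borel"
    using k by (rule borel_measurable_continuous_onI)
  have [measurable]: "g \<in> borel_measurable N" "h \<in> borel_measurable N"
    using g h by (auto intro: bdd_measurable_borel)
  show ?thesis
  proof (rule bdd_measurableI[of _ _ B])
    have "(\<lambda>x. (\<lambda>z. k (fst z) (snd z)) (g x, h x)) \<in> borel_measurable N"
      by (rule measurable_compose[of _ _ borel]) (auto intro!: borel_measurable_Pair)
    then show "(\<lambda>x. k (g x) (h x)) \<in> borel_measurable N" by simp
    show "\<bar>k (g x) (h x)\<bar> \<le> B" if "x \<in> space N" for x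
      using B[of "(g x, h x)"] C(2)[OF that] D(2)[OF that] by (auto simp: abs_le_iff)
  qed
qed

lemma bdd_measurable_exp [bm_intros]: "bdd_measurable N g \<Longrightarrow> bdd_measurable N (\<lambda>x. exp (g x))"
  by (rule bdd_measurable_continuous) (auto intro!: continuous_intros)

lemma bdd_measurable_abs [bm_intros]: "bdd_measurable N g \<Longrightarrow> bdd_measurable N (\<lambda>x. \<bar>g x\<bar>)"
  by (rule bdd_measurable_continuous) (auto intro!: continuous_intros)

lemma bdd_measurable_pos_part [bm_intros]:
  "bdd_measurable N g \<Longrightarrow> bdd_measurable N (\<lambda>x. max 0 (g x))"
  by (rule bdd_measurable_continuous) (auto intro!: continuous_intros)

lemma bdd_measurable_power [bm_intros]:
  "bdd_measurable N g \<Longrightarrow> bdd_measurable N (\<lambda>x. g x ^ k)"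
  by (rule bdd_measurable_continuous) (auto intro!: continuous_intros)

lemma bdd_measurable_uminus [bm_intros]: "bdd_measurable N g \<Longrightarrow> bdd_measurable N (\<lambda>x. - g x)"
  by (rule bdd_measurable_continuous) (auto intro!: continuous_intros)

lemma bdd_measurable_divide [bm_intros]: "bdd_measurable N g \<Longrightarrow> bdd_measurable N (\<lambda>x. g x / c)"
  unfolding divide_inverse by (intro bm_intros)

lemma bdd_measurable_diff [bm_intros]:
  "bdd_measurable N g \<Longrightarrow> bdd_measurable N h \<Longrightarrow> bdd_measurable N (\<lambda>x. g x - h x)"
  using bdd_measurable_add[of N g "\<lambda>x. - h x"] by (auto intro: bm_intros)

lemma bdd_measurable_sum [bm_intros]:
  assumes "\<And>i. i \<in> A \<Longrightarrow> bdd_measurable N (g i)"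
  shows "bdd_measurable N (\<lambda>x. \<Sum>i\<in>A. g i x)"
  using assms by (induction A rule: infinite_finite_induct) (auto intro: bm_intros)

lemma bdd_measurable_ln:
  assumes g: "bdd_measurable N g" and e: "0 < e" "\<And>x. x \<in> space N \<Longrightarrow> e \<le> g x"
  shows "bdd_measurable N (\<lambda>x. ln (g x))"
proof -
  obtain C where "0 < C" and C: "\<And>x. x \<in> space N \<Longrightarrow> \<bar>g x\<bar> \<le> C"
    using bdd_measurable_bound[OF g] by blast
  show ?thesis
  proof (rule bdd_measurableI)
    show "(\<lambda>x. ln (g x)) \<in> borel_measurable N"
      using bdd_measurable_borel[OF g] by measurable
    fix x assume x: "x \<in> space N"
    have "ln e \<le> ln (g x)" "ln (g x) \<le> ln C"
      using e(1) e(2)[OF x] C[OF x] by auto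
    then show "\<bar>ln (g x)\<bar> \<le> max \<bar>ln e\<bar> \<bar>ln C\<bar>" by linarith
  qed
qed

lemma bdd_measurable_compose:
  assumes "bdd_measurable N g" "u \<in> measurable L N"
  shows "bdd_measurable L (\<lambda>z. g (u z))"
proof -
  obtain C where "0 < C" and C: "\<And>x. x \<in> space N \<Longrightarrow> \<bar>g x\<bar> \<le> C"
    using bdd_measurable_bound[OF assms(1)] by blast
  show ?thesis
    using C measurable_space[OF assms(2)] measurable_compose[OF assms(2) bdd_measurable_borel[OF assms(1)]]
    by (intro bdd_measurableI[of _ _ C]) (simp_all add: Pi_iff)
qed

lemma (in prob_space) integrable_bdd_measurable:
  assumes "bdd_measurable M g" shows "integrable M g"
proof -
  obtain C where "0 < C" and "\<And>x. x \<in> space M \<Longrightarrow> \<bar>g x\<bar> \<le> C"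
    using bdd_measurable_bound[OF assms] by blast
  with assms show ?thesis
    by (intro integrable_const_bound[of _ C]) (auto intro: bdd_measurable_borel)
qed

lemma (in prob_space) expectation_mono_bdd:
  assumes "bdd_measurable M g" "bdd_measurable M h" "\<And>x. x \<in> space M \<Longrightarrow> g x \<le> h x"
  shows "expectation g \<le> expectation h"
  using assms by (intro integral_mono integrable_bdd_measurable)

lemma bdd_measurable_integral:
  assumes N: "prob_space N" and g: "bdd_measurable (L \<Otimes>\<^sub>M N) (\<lambda>z. g (fst z) (snd z))"
  shows "bdd_measurable L (\<lambda>x. \<integral>y. g x y \<partial>N)"
proof -
  interpret N: prob_space N by fact
  obtain C where "0 < C" and C: "\<And>z. z \<in> space (L \<Otimes>\<^sub>M N) \<Longrightarrow> \<bar>g (fst z) (snd z)\<bar> \<le> C"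
    using bdd_measurable_bound[OF g] by blast
  show ?thesis
  proof (rule bdd_measurableI)
    show "(\<lambda>x. \<integral>y. g x y \<partial>N) \<in> borel_measurable L"
      using bdd_measurable_borel[OF g]
      by (intro N.borel_measurable_lebesgue_integral) (simp add: case_prod_beta')
    fix x assume x: "x \<in> space L"
    have "bdd_measurable N (\<lambda>y. g x y)"
      using bdd_measurable_compose[OF g, of "\<lambda>y. (x, y)" N] x by simp
    then have i: "integrable N (g x)" by (rule N.integrable_bdd_measurable)
    have b: "\<bar>g x y\<bar> \<le> C" if "y \<in> space N" for y
      using C[of "(x, y)"] x that by (simp add: space_pair_measure)
    have "\<bar>\<integral>y. g x y \<partial>N\<bar> \<le> (\<integral>y. \<bar>g x y\<bar> \<partial>N)" by (rule integral_abs_bound)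
    also have "\<dots> \<le> (\<integral>y. C \<partial>N)" using i b by (intro integral_mono) auto
    finally show "\<bar>\<integral>y. g x y \<partial>N\<bar> \<le> C" by (simp add: N.prob_space)
  qed
qed

lemma integral_swap_bdd:
  assumes L: "prob_space L" and N: "prob_space N"
    and g: "bdd_measurable (L \<Otimes>\<^sub>M N) (\<lambda>z. g (fst z) (snd z))"
  shows "(\<integral>x. (\<integral>y. g x y \<partial>N) \<partial>L) = (\<integral>y. (\<integral>x. g x y \<partial>L) \<partial>N)"
proof -
  interpret L: prob_space L by fact
  interpret N: prob_space N by fact
  interpret LN: pair_prob_space L N ..
  have "integrable (L \<Otimes>\<^sub>M N) (\<lambda>z. g (fst z) (snd z))"
    using g by (rule LN.integrable_bdd_measurable)
  then show ?thesis
    using LN.Fubini_integral[of g] by (simp add: case_prod_beta')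
qed

text \<open>
  Exchanging the names of two independent copies turns the double integral into that of the
  symmetric part of the kernel.
\<close>

lemma double_integral_nonneg_symmetric:
  assumes N: "prob_space N" and k: "bdd_measurable (N \<Otimes>\<^sub>M N) (\<lambda>z. k (fst z) (snd z))"
    and sym: "\<And>y z. y \<in> space N \<Longrightarrow> z \<in> space N \<Longrightarrow> 0 \<le> k y z + k z y"
  shows "0 \<le> (\<integral>y. (\<integral>z. k y z \<partial>N) \<partial>N)"
proof -
  interpret N: prob_space N by fact
  let ?J = "\<integral>y. (\<integral>z. k y z \<partial>N) \<partial>N"
  have k': "bdd_measurable (N \<Otimes>\<^sub>M N) (\<lambda>z. k (snd z) (fst z))"
    using bdd_measurable_compose[OF k, of "\<lambda>z. (snd z, fst z)" "N \<Otimes>\<^sub>M N"] by simp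
  have i: "integrable N (\<lambda>z. k y z)" "integrable N (\<lambda>z. k z y)" if "y \<in> space N" for y
    using bdd_measurable_compose[OF k, of "\<lambda>z. (y, z)" N]
      bdd_measurable_compose[OF k', of "\<lambda>z. (y, z)" N] that
    by (auto intro: N.integrable_bdd_measurable)
  have "?J + ?J = ?J + (\<integral>y. (\<integral>z. k z y \<partial>N) \<partial>N)"
    using integral_swap_bdd[OF N N k] by simp
  also have "\<dots> = (\<integral>y. (\<integral>z. k y z \<partial>N) + (\<integral>z. k z y \<partial>N) \<partial>N)"
    by (subst Bochner_Integration.integral_add)
      (auto intro!: N.integrable_bdd_measurable bdd_measurable_integral[OF N] k k')
  also have "\<dots> \<ge> 0"
  proof (rule integral_nonneg_AE, rule AE_I2)
    fix y assume y: "y \<in> space N"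
    have "(\<integral>z. k y z \<partial>N) + (\<integral>z. k z y \<partial>N) = (\<integral>z. k y z + k z y \<partial>N)"
      using i[OF y] by simp
    also have "\<dots> \<ge> 0" using sym[OF y] by (intro integral_nonneg_AE AE_I2) auto
    finally show "0 \<le> (\<integral>z. k y z \<partial>N) + (\<integral>z. k z y \<partial>N)" .
  qed
  finally show ?thesis by simp
qed

section \<open>Integrating out coordinates of a product\<close>

locale finite_probability_product =
  fixes I :: "'i set" and M :: "'i \<Rightarrow> 'a measure"
  assumes finite_index: "finite I" and prob_factor: "\<And>i. i \<in> I \<Longrightarrow> prob_space (M i)"

sublocale finite_probability_product \<subseteq> prob_space "Pi\<^sub>M I M"
  by (rule prob_space_PiM) (rule prob_factor)

context finite_probability_product
begin

abbreviation bm :: "(('i \<Rightarrow> 'a) \<Rightarrow> real) \<Rightarrow> bool" where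
  "bm \<equiv> bdd_measurable (Pi\<^sub>M I M)"

definition average :: "'i \<Rightarrow> (('i \<Rightarrow> 'a) \<Rightarrow> real) \<Rightarrow> ('i \<Rightarrow> 'a) \<Rightarrow> real" where
  "average i g x = (\<integral>y. g (x(i := y)) \<partial>M i)"

definition ignores :: "(('i \<Rightarrow> 'a) \<Rightarrow> real) \<Rightarrow> 'i \<Rightarrow> bool" where
  "ignores g i \<longleftrightarrow> (\<forall>x\<in>space (Pi\<^sub>M I M). \<forall>y\<in>space (M i). g (x(i := y)) = g x)"

lemma ignoresD: "ignores g i \<Longrightarrow> x \<in> space (Pi\<^sub>M I M) \<Longrightarrow> y \<in> space (M i) \<Longrightarrow> g (x(i := y)) = g x"
  unfolding ignores_def by blast

lemma update_in_space:
  "x \<in> space (Pi\<^sub>M I M) \<Longrightarrow> i \<in> I \<Longrightarrow> y \<in> space (M i) \<Longrightarrow> x(i := y) \<in> space (Pi\<^sub>M I M)"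
  by (auto simp: space_PiM PiE_iff extensional_def)

lemma coordinate_in_space: "x \<in> space (Pi\<^sub>M I M) \<Longrightarrow> i \<in> I \<Longrightarrow> x i \<in> space (M i)"
  by (auto simp: space_PiM PiE_iff)

lemma update_measurable:
  assumes "i \<in> I" "u \<in> measurable N (Pi\<^sub>M I M)" "w \<in> measurable N (M i)"
  shows "(\<lambda>z. (u z)(i := w z)) \<in> measurable N (Pi\<^sub>M I M)"
  by (rule measurable_fun_upd[of I I]) (use assms in auto)

lemma bdd_measurable_update:
  assumes "bm g" "i \<in> I" "u \<in> measurable N (Pi\<^sub>M I M)" "w \<in> measurable N (M i)"
  shows "bdd_measurable N (\<lambda>z. g ((u z)(i := w z)))"
  by (rule bdd_measurable_compose[OF assms(1) update_measurable[OF assms(2-4)]])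

lemma bdd_measurable_section:
  assumes "bm g" "i \<in> I" "x \<in> space (Pi\<^sub>M I M)"
  shows "bdd_measurable (M i) (\<lambda>y. g (x(i := y)))"
  by (rule bdd_measurable_update[OF assms(1,2)]) (use assms in auto)

lemma bm_average [bm_intros]: "bm g \<Longrightarrow> i \<in> I \<Longrightarrow> bm (average i g)"
  unfolding average_def
  by (intro bdd_measurable_integral prob_factor bdd_measurable_update[of g]) auto

lemma average_ignores: "ignores (average i g) i"
  by (simp add: ignores_def average_def)

lemma average_preserves_ignores:
  assumes g: "ignores g j" and i: "i \<in> I"
  shows "ignores (average i g) j"
  unfolding ignores_def average_def
proof (intro ballI)
  fix x z assume x: "x \<in> space (Pi\<^sub>M I M)" and z: "z \<in> space (M j)"
  show "(\<integral>y. g ((x(j := z))(i := y)) \<partial>M i) = (\<integral>y. g (x(i := y)) \<partial>M i)"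
  proof (rule Bochner_Integration.integral_cong[OF refl])
    fix y assume y: "y \<in> space (M i)"
    show "g ((x(j := z))(i := y)) = g (x(i := y))"
      using ignoresD[OF g update_in_space[OF x i y] z]
      by (cases "i = j") (auto simp: fun_upd_twist)
  qed
qed

text \<open>
  Two points of the space differ in finitely many coordinates, which can be changed one at a time.
\<close>

lemma ignores_all_constant:
  assumes g: "\<And>i. i \<in> I \<Longrightarrow> ignores g i"
    and x: "x \<in> space (Pi\<^sub>M I M)" and y: "y \<in> space (Pi\<^sub>M I M)"
  shows "g x = g y"
proof -
  have "finite J \<Longrightarrow> J \<subseteq> I \<Longrightarrow> g (override_on x y J) = g x \<and> override_on x y J \<in> space (Pi\<^sub>M I M)" for J
  proof (induction J rule: finite_induct)
    case empty
    then show ?case using x by simp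
  next
    case (insert j J)
    have eq: "override_on x y (insert j J) = (override_on x y J)(j := y j)"
      by (auto simp: override_on_def)
    have j: "j \<in> I" and IH: "g (override_on x y J) = g x" "override_on x y J \<in> space (Pi\<^sub>M I M)"
      using insert by auto
    have "y j \<in> space (M j)" using y j by (rule coordinate_in_space)
    then show ?case
      unfolding eq using ignoresD[OF g[OF j] IH(2)] IH(1) update_in_space[OF IH(2) j] by metis
  qed
  from this[OF finite_index subset_refl] have "g (override_on x y I) = g x" by simp
  moreover have "override_on x y I = y"
    using x y by (auto simp: override_on_def space_PiM PiE_iff extensional_def fun_eq_iff)
  ultimately show ?thesis by simp
qed

lemma integral_section:
  fixes g :: "('i \<Rightarrow> 'a) \<Rightarrow> real"
  assumes i: "i \<in> I" and g: "integrable (Pi\<^sub>M I M) g"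
  shows "expectation g = (\<integral>x. (\<integral>y. g (x(i := y)) \<partial>M i) \<partial>Pi\<^sub>M (I - {i}) M)"
proof -
  interpret Mi: prob_space "M i" using i by (rule prob_factor)
  interpret R: prob_space "Pi\<^sub>M (I - {i}) M" by (rule prob_space_PiM) (auto intro: prob_factor)
  interpret Q: pair_prob_space "M i" "Pi\<^sub>M (I - {i}) M" ..
  let ?u = "\<lambda>(y, x). x(i := y)"
  have u: "?u \<in> measurable (M i \<Otimes>\<^sub>M Pi\<^sub>M (I - {i}) M) (Pi\<^sub>M I M)"
    unfolding case_prod_beta'
    by (rule measurable_fun_upd[of _ "I - {i}"]) (use i in auto)
  have eq: "distr (M i \<Otimes>\<^sub>M Pi\<^sub>M (I - {i}) M) (Pi\<^sub>M I M) ?u = Pi\<^sub>M I M"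
    using distr_pair_PiM_eq_PiM[of "I - {i}" M i] prob_factor i by (simp add: insert_absorb)
  have "expectation g = integral\<^sup>L (distr (M i \<Otimes>\<^sub>M Pi\<^sub>M (I - {i}) M) (Pi\<^sub>M I M) ?u) g"
    by (simp only: eq)
  also have "\<dots> = (\<integral>z. g (?u z) \<partial>(M i \<Otimes>\<^sub>M Pi\<^sub>M (I - {i}) M))"
    using g by (intro integral_distr u) auto
  also have "\<dots> = (\<integral>x. (\<integral>y. g (x(i := y)) \<partial>M i) \<partial>Pi\<^sub>M (I - {i}) M)"
  proof -
    have "integrable (distr (M i \<Otimes>\<^sub>M Pi\<^sub>M (I - {i}) M) (Pi\<^sub>M I M) ?u) g"
      using g by (simp only: eq)
    then have "integrable (M i \<Otimes>\<^sub>M Pi\<^sub>M (I - {i}) M) (\<lambda>(y, x). g (x(i := y)))"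
      using integrable_distr[OF u] by (simp add: case_prod_beta')
    from Q.integral_snd[OF this] show ?thesis by (simp add: case_prod_beta')
  qed
  finally show ?thesis .
qed

lemma expectation_average:
  assumes i: "i \<in> I" and g: "bm g"
  shows "expectation (average i g) = expectation g"
proof -
  interpret Mi: prob_space "M i" using i by (rule prob_factor)
  have "expectation (average i g) = (\<integral>x. (\<integral>y. average i g (x(i := y)) \<partial>M i) \<partial>Pi\<^sub>M (I - {i}) M)"
    by (intro integral_section i integrable_bdd_measurable bm_average g)
  also have "\<dots> = (\<integral>x. (\<integral>y. g (x(i := y)) \<partial>M i) \<partial>Pi\<^sub>M (I - {i}) M)"
    by (simp add: average_def Mi.prob_space)
  also have "\<dots> = expectation g"
    by (intro integral_section[symmetric] i integrable_bdd_measurable g)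
  finally show ?thesis .
qed

lemma average_mult_ignores:
  assumes "ignores h i" "i \<in> I" "x \<in> space (Pi\<^sub>M I M)"
  shows "average i (\<lambda>x. g x * h x) x = average i g x * h x"
  unfolding average_def integral_mult_left_zero[symmetric]
  by (rule Bochner_Integration.integral_cong) (use assms ignoresD in auto)

lemma expectation_average_mult:
  assumes i: "i \<in> I" and g: "bm g" and h: "bm h" "ignores h i"
  shows "expectation (\<lambda>x. average i g x * h x) = expectation (\<lambda>x. g x * h x)"
proof -
  have "expectation (\<lambda>x. g x * h x) = expectation (average i (\<lambda>x. g x * h x))"
    by (intro expectation_average[symmetric] i bm_intros g h)
  also have "\<dots> = expectation (\<lambda>x. average i g x * h x)"
    by (intro Bochner_Integration.integral_cong average_mult_ignores refl h i)
  finally show ?thesis by simp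
qed

lemma average_diff:
  assumes "bm g" "bm h" "i \<in> I" "x \<in> space (Pi\<^sub>M I M)"
  shows "average i (\<lambda>x. g x - h x) x = average i g x - average i h x"
proof -
  interpret Mi: prob_space "M i" by (rule prob_factor) fact
  show ?thesis unfolding average_def
    by (intro Bochner_Integration.integral_diff Mi.integrable_bdd_measurable
        bdd_measurable_section[of g] bdd_measurable_section[of h] assms)
qed

text \<open>
  This is Fubini's theorem for the two coordinates, with the other ones frozen.
\<close>

lemma average_commute:
  assumes "bm g" "i \<in> I" "j \<in> I" "i \<noteq> j" "x \<in> space (Pi\<^sub>M I M)"
  shows "average i (average j g) x = average j (average i g) x"
proof -
  have "(\<integral>y. (\<integral>z. g (x(i := y, j := z)) \<partial>M j) \<partial>M i) = (\<integral>z. (\<integral>y. g (x(i := y, j := z)) \<partial>M i) \<partial>M j)"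
    using assms
    by (intro integral_swap_bdd prob_factor bdd_measurable_update[of g] update_measurable) auto
  then show ?thesis
    unfolding average_def using assms by (simp add: fun_upd_twist)
qed

end

section \<open>The modified logarithmic Sobolev inequality\<close>

text \<open>
  This is \<open>tanh(t/2) \<le> t/2\<close> cleared of denominators.
\<close>

lemma exp_difference_le_mean:
  fixes t :: real
  assumes "0 \<le> t"
  shows "2 * (exp t - 1) \<le> t * (exp t + 1)"
proof -
  let ?h = "\<lambda>t::real. t * (exp t + 1) - 2 * (exp t - 1)"
  have "?h 0 \<le> ?h t"
  proof (rule DERIV_nonneg_imp_nondecreasing[OF assms])
    fix s :: real
    have "(?h has_real_derivative (exp s + 1 + s * exp s - 2 * exp s)) (at s)"
      by (auto intro!: derivative_eq_intros simp: algebra_simps)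
    moreover have "0 \<le> exp s + 1 + s * exp s - 2 * exp s"
    proof -
      have "(1 - s) * exp s \<le> exp (- s) * exp s"
        using exp_ge_add_one_self[of "-s"] by (intro mult_right_mono) auto
      also have "\<dots> = 1" by (simp flip: exp_add)
      finally show ?thesis by (simp add: algebra_simps)
    qed
    ultimately show "\<exists>y. (?h has_real_derivative y) (at s) \<and> 0 \<le> y" by blast
  qed
  then show ?thesis by simp
qed

lemma exp_difference_quadratic:
  fixes a b :: real
  shows "(a - b) * (exp a - exp b) \<le> exp a * ((a - b)\<^sup>2 / 2) + exp b * ((b - a)\<^sup>2 / 2)"
proof -
  have *: "(a - b) * (exp a - exp b) \<le> exp a * ((a - b)\<^sup>2 / 2) + exp b * ((b - a)\<^sup>2 / 2)"
    if "b \<le> a" for a b :: real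
  proof -
    have "(a - b) * exp b * (2 * (exp (a - b) - 1)) \<le> (a - b) * exp b * ((a - b) * (exp (a - b) + 1))"
      using that by (intro mult_left_mono exp_difference_le_mean) auto
    moreover have "exp a = exp b * exp (a - b)" by (simp flip: exp_add)
    ultimately show ?thesis
      by (simp add: power2_eq_square field_simps)
  qed
  show ?thesis
    using *[of a b] *[of b a] by (cases "b \<le> a") (auto simp: algebra_simps)
qed

lemma exp_difference_one_sided:
  fixes a b :: real
  shows "(a - b) * (exp a - exp b) \<le> exp a * (max 0 (a - b))\<^sup>2 + exp b * (max 0 (b - a))\<^sup>2"
proof -
  have *: "(a - b) * (exp a - exp b) \<le> exp a * (a - b)\<^sup>2" if "b \<le> a" for a b :: real
  proof -
    have "exp a * (1 + (b - a)) \<le> exp a * exp (b - a)"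
      using exp_ge_add_one_self[of "b - a"] by (intro mult_left_mono) auto
    also have "\<dots> = exp b" by (simp flip: exp_add)
    finally have "exp a - exp b \<le> exp a * (a - b)" by (simp add: algebra_simps)
    then have "(a - b) * (exp a - exp b) \<le> (a - b) * (exp a * (a - b))"
      using that by (intro mult_left_mono) auto
    then show ?thesis by (simp add: power2_eq_square algebra_simps)
  qed
  show ?thesis
  proof (cases "b \<le> a")
    case True
    then show ?thesis using *[OF True] by simp
  next
    case False
    then show ?thesis using *[of a b] by (simp add: algebra_simps)
  qed
qed

text \<open>
  The entropy of the function \<open>e\<^sup>F\<close>. The exponent is the argument because Herbst's argument scales it.
\<close>

definition (in prob_space) exp_entropy :: "('a \<Rightarrow> real) \<Rightarrow> real" where
  "exp_entropy F = expectation (\<lambda>x. exp (F x) * F x)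
     - expectation (\<lambda>x. exp (F x)) * ln (expectation (\<lambda>x. exp (F x)))"

context finite_probability_product
begin

abbreviation averages :: "'i list \<Rightarrow> (('i \<Rightarrow> 'a) \<Rightarrow> real) \<Rightarrow> ('i \<Rightarrow> 'a) \<Rightarrow> real" where
  "averages js g \<equiv> foldr average js g"

lemma bm_averages: "bm g \<Longrightarrow> set js \<subseteq> I \<Longrightarrow> bm (averages js g)"
  by (induction js) (auto intro: bm_average)

lemma averages_ignores:
  "set js \<subseteq> I \<Longrightarrow> j \<in> set js \<Longrightarrow> ignores (averages js g) j"
  by (induction js) (auto intro: average_ignores average_preserves_ignores)

lemma expectation_averages:
  "set js \<subseteq> I \<Longrightarrow> bm g \<Longrightarrow> expectation (averages js g) = expectation g"
  by (induction js) (auto simp: expectation_average bm_averages)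

lemma expectation_averages_mult:
  assumes "set js \<subseteq> I" "bm g" "bm h" "\<And>j. j \<in> set js \<Longrightarrow> ignores h j"
  shows "expectation (\<lambda>x. averages js g x * h x) = expectation (\<lambda>x. g x * h x)"
  using assms by (induction js) (auto simp: expectation_average_mult bm_averages)

text \<open>
  Once all coordinates are integrated out the function is constant, and averaging preserves the mean.
\<close>

lemma averages_all:
  assumes js: "set js = I" and g: "bm g" and x: "x \<in> space (Pi\<^sub>M I M)"
  shows "averages js g x = expectation g"
proof -
  have "expectation (averages js g) = expectation (\<lambda>_. averages js g x)"
    using js x by (intro Bochner_Integration.integral_cong ignores_all_constant averages_ignores) auto
  then show ?thesis
    using expectation_averages[of js g] js g by (simp add: prob_space)
qed

lemma average_lower_bound:
  assumes "bm g" "i \<in> I" "\<And>x. x \<in> space (Pi\<^sub>M I M) \<Longrightarrow> e \<le> g x" "x \<in> space (Pi\<^sub>M I M)"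
  shows "e \<le> average i g x"
proof -
  interpret Mi: prob_space "M i" by (rule prob_factor) fact
  have "Mi.expectation (\<lambda>_. e) \<le> average i g x"
    unfolding average_def
    by (intro integral_mono Mi.integrable_bdd_measurable bdd_measurable_const
        bdd_measurable_section[OF assms(1,2,4)] assms(3)[OF update_in_space[OF assms(4,2)]])
  then show ?thesis by (simp add: Mi.prob_space)
qed

lemma averages_lower_bound:
  assumes "bm g" "set js \<subseteq> I" "\<And>x. x \<in> space (Pi\<^sub>M I M) \<Longrightarrow> e \<le> g x"
  shows "x \<in> space (Pi\<^sub>M I M) \<Longrightarrow> e \<le> averages js g x"
  using assms(2)
proof (induction js arbitrary: x)
  case (Cons j js)
  then show ?case
    using assms(1) by (auto intro!: average_lower_bound bm_averages)
qed (use assms(3) in auto)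

lemma exp_lower_bound:
  assumes "bm F"
  obtains e where "0 < e" "\<And>x. x \<in> space (Pi\<^sub>M I M) \<Longrightarrow> e \<le> exp (F x)"
proof -
  obtain C where "\<And>x. x \<in> space (Pi\<^sub>M I M) \<Longrightarrow> \<bar>F x\<bar> \<le> C"
    using bdd_measurable_bound[OF assms] by blast
  then show ?thesis
    by (intro that[of "exp (- C)"]) (auto simp: abs_le_iff minus_le_iff)
qed

text \<open>
  One summand in the chain rule for the entropy. If \<open>H\<close> and \<open>E\<^sub>k H\<close> are marginals of \<open>e\<^sup>F\<close>, the left side is
  the contribution of the \<open>k\<close>-th coordinate. As \<open>E\<^sub>k(H / E\<^sub>k H) = 1\<close>, the inequality is the variational
  formula for the entropy in the \<open>k\<close>-th coordinate followed by Jensen's inequality for \<open>ln\<close>, and both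
  are instances of \<open>1 + t \<le> e\<^sup>t\<close>.
\<close>

lemma entropy_step:
  assumes F: "bm F" and H: "bm H" and e: "0 < e" "\<And>x. x \<in> space (Pi\<^sub>M I M) \<Longrightarrow> e \<le> H x"
    and k: "k \<in> I"
  shows "expectation (\<lambda>x. exp (F x) * (ln (H x) - ln (average k H x)))
    \<le> expectation (\<lambda>x. exp (F x) * (F x - average k F x))"
proof -
  let ?F = "average k F" and ?H = "average k H"
  have e': "e \<le> ?H x" if "x \<in> space (Pi\<^sub>M I M)" for x
    using H k e(2) that by (rule average_lower_bound)
  note bm = bm_intros F H k bdd_measurable_ln[OF H e] bdd_measurable_ln[OF bm_average[OF H k] e(1) e']
  have bal: "expectation (\<lambda>x. average k g x * exp (?F x - ln (?H x)))
      = expectation (\<lambda>x. g x * exp (?F x - ln (?H x)))" if "bm g" for g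
    using that average_ignores[of k F] average_ignores[of k H]
    by (intro expectation_average_mult k bm) (auto simp: ignores_def)
  have "0 \<le> expectation (\<lambda>x. exp (F x) - exp (?F x))"
  proof -
    have "expectation (\<lambda>x. (F x - ?F x) * exp (?F x)) \<le> expectation (\<lambda>x. exp (F x) - exp (?F x))"
    proof (intro expectation_mono_bdd bm)
      fix x
      have "exp (?F x) * (1 + (F x - ?F x)) \<le> exp (?F x) * exp (F x - ?F x)"
        by (intro mult_left_mono exp_ge_add_one_self) auto
      then show "(F x - ?F x) * exp (?F x) \<le> exp (F x) - exp (?F x)"
        by (simp add: algebra_simps flip: exp_add)
    qed
    moreover have "expectation (\<lambda>x. (F x - ?F x) * exp (?F x)) = 0"
    proof -
      have "expectation (\<lambda>x. ?F x * exp (?F x)) = expectation (\<lambda>x. F x * exp (?F x))"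
        using average_ignores[of k F]
        by (intro expectation_average_mult bm) (auto simp: ignores_def)
      then show ?thesis
        by (simp add: left_diff_distrib integrable_bdd_measurable bm)
    qed
    ultimately show ?thesis by simp
  qed
  also have "\<dots> = expectation (\<lambda>x. exp (F x)) - expectation (\<lambda>x. exp (?F x))"
    by (simp add: integrable_bdd_measurable bm)
  also have "expectation (\<lambda>x. exp (?F x)) = expectation (\<lambda>x. ?H x * exp (?F x - ln (?H x)))"
  proof (intro Bochner_Integration.integral_cong refl)
    fix x assume "x \<in> space (Pi\<^sub>M I M)"
    then show "exp (?F x) = ?H x * exp (?F x - ln (?H x))"
      using e(1) e'[of x] by (simp add: exp_diff)
  qed
  also have "\<dots> = expectation (\<lambda>x. H x * exp (?F x - ln (?H x)))"
    by (rule bal[OF H])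
  also have "expectation (\<lambda>x. exp (F x)) - \<dots> = expectation (\<lambda>x. exp (F x) - H x * exp (?F x - ln (?H x)))"
    by (intro Bochner_Integration.integral_diff[symmetric] integrable_bdd_measurable bm)
  also have "\<dots> \<le> expectation (\<lambda>x. exp (F x) * (F x - ?F x) - exp (F x) * (ln (H x) - ln (?H x)))"
  proof (intro expectation_mono_bdd bm)
    fix x assume x: "x \<in> space (Pi\<^sub>M I M)"
    let ?t = "F x - ?F x - (ln (H x) - ln (?H x))"
    have "exp (F x) * (1 + (- ?t)) \<le> exp (F x) * exp (- ?t)"
      by (intro mult_left_mono exp_ge_add_one_self) auto
    also have "\<dots> = exp (F x + - ?t)" by (simp only: exp_add)
    also have "F x + - ?t = ln (H x) + (?F x - ln (?H x))" by simp
    also have "exp \<dots> = H x * exp (?F x - ln (?H x))"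
      using e(1) e(2)[OF x] by (simp only: exp_add) simp
    finally show "exp (F x) - H x * exp (?F x - ln (?H x))
        \<le> exp (F x) * (F x - ?F x) - exp (F x) * (ln (H x) - ln (?H x))"
      by (simp add: algebra_simps)
  qed
  also have "\<dots> = expectation (\<lambda>x. exp (F x) * (F x - ?F x))
      - expectation (\<lambda>x. exp (F x) * (ln (H x) - ln (?H x)))"
    by (intro Bochner_Integration.integral_diff integrable_bdd_measurable bm)
  finally show ?thesis by simp
qed

text \<open>
  Let \<open>G = e\<^sup>F\<close> and integrate out one coordinate after the other. The logarithm of \<open>G / E G\<close> is the
  telescoping sum of the logarithms of the quotients of successive marginals, and each of
  them is handled by \<open>entropy_step\<close>. The right side is the sum of the mean covariances of \<open>F\<close> and \<open>e\<^sup>F\<close> in the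
  single coordinates.
\<close>

lemma exp_entropy_subadditive:
  assumes F: "bm F"
  shows "exp_entropy F \<le> (\<Sum>i\<in>I. expectation (\<lambda>x. exp (F x) * (F x - average i F x)))"
proof -
  obtain e where e: "0 < e" "\<And>x. x \<in> space (Pi\<^sub>M I M) \<Longrightarrow> e \<le> exp (F x)"
    using exp_lower_bound[OF F] by blast
  let ?G = "\<lambda>x. exp (F x)"
  have G: "bm ?G" by (intro bm_intros F)
  obtain js where js: "set js = I" "distinct js"
    using finite_distinct_list[OF finite_index] by blast
  have bmln: "bm (\<lambda>x. ln (averages js ?G x))" if "set js \<subseteq> I" for js
    using that averages_lower_bound[OF G that e(2)] by (intro bdd_measurable_ln[of _ _ e] bm_averages G e(1))
  have "expectation (\<lambda>x. ?G x * (F x - ln (averages js ?G x)))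
      \<le> (\<Sum>i\<leftarrow>js. expectation (\<lambda>x. ?G x * (F x - average i F x)))" if "set js \<subseteq> I" for js
    using that
  proof (induction js)
    case (Cons k ks)
    have "expectation (\<lambda>x. ?G x * (F x - ln (averages (k # ks) ?G x)))
      = expectation (\<lambda>x. ?G x * (F x - ln (averages ks ?G x))
          + ?G x * (ln (averages ks ?G x) - ln (average k (averages ks ?G) x)))"
      by (simp add: algebra_simps)
    also have "\<dots> = expectation (\<lambda>x. ?G x * (F x - ln (averages ks ?G x)))
        + expectation (\<lambda>x. ?G x * (ln (averages ks ?G x) - ln (average k (averages ks ?G) x)))"
      using bmln[of ks] bmln[of "k # ks"] Cons.prems
      by (intro Bochner_Integration.integral_add integrable_bdd_measurable bm_intros F) auto
    also have "expectation (\<lambda>x. ?G x * (ln (averages ks ?G x) - ln (average k (averages ks ?G) x)))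
        \<le> expectation (\<lambda>x. ?G x * (F x - average k F x))"
      using Cons.prems
      by (intro entropy_step[of F _ e] F bm_averages G e averages_lower_bound) auto
    also have "expectation (\<lambda>x. ?G x * (F x - ln (averages ks ?G x)))
        \<le> (\<Sum>i\<leftarrow>ks. expectation (\<lambda>x. ?G x * (F x - average i F x)))"
      using Cons by simp
    finally show ?case by simp
  qed simp
  from this[of js] have "expectation (\<lambda>x. ?G x * (F x - ln (averages js ?G x)))
      \<le> (\<Sum>i\<in>I. expectation (\<lambda>x. ?G x * (F x - average i F x)))"
    using js by (simp add: sum_list_distinct_conv_sum_set)
  moreover have "expectation (\<lambda>x. ?G x * (F x - ln (averages js ?G x)))
      = expectation (\<lambda>x. ?G x * F x - ?G x * ln (expectation ?G))"
    using js by (intro Bochner_Integration.integral_cong)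
      (auto simp: averages_all[OF js(1) G] right_diff_distrib)
  moreover have "\<dots> = exp_entropy F"
    unfolding exp_entropy_def
    by (subst Bochner_Integration.integral_diff) (auto intro!: integrable_bdd_measurable bm_intros F)
  ultimately show ?thesis by simp
qed

text \<open>
  Given the other coordinates, \<open>x i\<close> and \<open>y\<close> are independent with the same law, so only the symmetric
  part of the kernel contributes.
\<close>

lemma expectation_symmetric_kernel_nonneg:
  fixes k :: "real \<Rightarrow> real \<Rightarrow> real"
  assumes F: "bm F" and i: "i \<in> I" and k: "continuous_on UNIV (\<lambda>z. k (fst z) (snd z))"
    and sym: "\<And>a b. 0 \<le> k a b + k b a"
  shows "0 \<le> expectation (\<lambda>x. \<integral>y. k (F x) (F (x(i := y))) \<partial>M i)"
proof -
  have K: "bm (\<lambda>x. \<integral>y. k (F x) (F (x(i := y))) \<partial>M i)"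
    by (intro bdd_measurable_integral prob_factor i bdd_measurable_continuous2[OF _ _ k]
        bdd_measurable_update[OF F] bdd_measurable_compose[OF F]) auto
  have "0 \<le> expectation (average i (\<lambda>x. \<integral>y. k (F x) (F (x(i := y))) \<partial>M i))"
  proof (rule integral_nonneg_AE, rule AE_I2)
    fix x assume x: "x \<in> space (Pi\<^sub>M I M)"
    have "0 \<le> (\<integral>z. (\<integral>y. k (F (x(i := z))) (F (x(i := y))) \<partial>M i) \<partial>M i)"
      using x i
      by (intro double_integral_nonneg_symmetric prob_factor sym bdd_measurable_continuous2[OF _ _ k]
          bdd_measurable_update[OF F]) auto
    then show "0 \<le> average i (\<lambda>x. \<integral>y. k (F x) (F (x(i := y))) \<partial>M i) x"
      by (simp add: average_def)
  qed
  then show ?thesis using expectation_average[OF i K] by simp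
qed

text \<open>
  The mean covariance of \<open>F\<close> and \<open>e\<^sup>F\<close> in coordinate \<open>i\<close> is half the integral of
  \<open>(a - b) (e\<^sup>a - e\<^sup>b)\<close> over \<open>a = F x\<close> and \<open>b = F (x(i := y))\<close>. The weight \<open>c\<close> stands for \<open>t\<^sup>2 / 2\<close> or for the square of
  the positive part of \<open>t\<close>.
\<close>

theorem modified_log_Sobolev:
  fixes c :: "real \<Rightarrow> real"
  assumes F: "bm F" and c: "continuous_on UNIV c"
    and ineq: "\<And>a b. (a - b) * (exp a - exp b) \<le> exp a * c (a - b) + exp b * c (b - a)"
  shows "exp_entropy F \<le> expectation (\<lambda>x. exp (F x) * (\<Sum>i\<in>I. \<integral>y. c (F x - F (x(i := y))) \<partial>M i))"
proof -
  let ?C = "\<lambda>i x. \<integral>y. c (F x - F (x(i := y))) \<partial>M i"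
  have cd: "continuous_on UNIV (\<lambda>z. c (fst z - snd z))"
    by (rule continuous_on_compose2[OF c]) (auto intro!: continuous_intros)
  have C: "bm (?C i)" if "i \<in> I" for i
    using that
    by (intro bdd_measurable_integral prob_factor bdd_measurable_continuous2[OF _ _ cd]
        bdd_measurable_update[OF F] bdd_measurable_compose[OF F]) auto
  have "expectation (\<lambda>x. exp (F x) * (F x - average i F x)) \<le> expectation (\<lambda>x. exp (F x) * ?C i x)"
    if i: "i \<in> I" for i
  proof -
    interpret Mi: prob_space "M i" using i by (rule prob_factor)
    let ?k = "\<lambda>a b. exp a * (c (a - b) - (a - b))"
    have "0 \<le> expectation (\<lambda>x. \<integral>y. ?k (F x) (F (x(i := y))) \<partial>M i)"
    proof (intro expectation_symmetric_kernel_nonneg F i)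
      show "continuous_on UNIV (\<lambda>z. ?k (fst z) (snd z))"
        by (intro continuous_intros cd)
      show "0 \<le> ?k a b + ?k b a" for a b
        using ineq[of a b] by (simp add: algebra_simps)
    qed
    also have "\<dots> = expectation (\<lambda>x. exp (F x) * ?C i x - exp (F x) * (F x - average i F x))"
    proof (intro Bochner_Integration.integral_cong refl)
      fix x assume x: "x \<in> space (Pi\<^sub>M I M)"
      have s: "bdd_measurable (M i) (\<lambda>y. F (x(i := y)))" by (rule bdd_measurable_section[OF F i x])
      have "bdd_measurable (M i) (\<lambda>y. c (F x - F (x(i := y))))"
        by (rule bdd_measurable_continuous[OF _ c]) (intro bm_intros s)
      then show "(\<integral>y. ?k (F x) (F (x(i := y))) \<partial>M i)
          = exp (F x) * ?C i x - exp (F x) * (F x - average i F x)"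
        using s by (simp add: average_def Mi.integrable_bdd_measurable Mi.prob_space
            right_diff_distrib)
    qed
    also have "\<dots> = expectation (\<lambda>x. exp (F x) * ?C i x) - expectation (\<lambda>x. exp (F x) * (F x - average i F x))"
      by (intro Bochner_Integration.integral_diff integrable_bdd_measurable bm_intros F C i)
    finally show ?thesis by simp
  qed
  then have "exp_entropy F \<le> (\<Sum>i\<in>I. expectation (\<lambda>x. exp (F x) * ?C i x))"
    using exp_entropy_subadditive[OF F] by (meson order_trans sum_mono)
  also have "\<dots> = expectation (\<lambda>x. exp (F x) * (\<Sum>i\<in>I. ?C i x))"
    unfolding sum_distrib_left
    by (intro Bochner_Integration.integral_sum[symmetric] integrable_bdd_measurable bm_intros F C)
  finally show ?thesis .
qed

end

section \<open>From entropy bounds to exponential moments\<close>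

lemma exp_second_order_remainder:
  fixes u :: real
  assumes "\<bar>u\<bar> \<le> 1"
  shows "\<bar>exp u - 1 - u\<bar> \<le> u\<^sup>2"
proof -
  have "exp u \<le> 1 + u + u\<^sup>2"
  proof (cases "0 \<le> u")
    case True
    then show ?thesis using exp_bound[of u] assms by simp
  next
    case False
    have "exp u * (1 - u) \<le> exp u * exp (- u)"
      using exp_ge_add_one_self[of "- u"] by (intro mult_left_mono) auto
    also have "\<dots> = 1" by (simp flip: exp_add)
    also have "1 \<le> (1 + u + u\<^sup>2) * (1 - u)"
    proof -
      have "(1 + u + u\<^sup>2) * (1 - u) = 1 + (- u) ^ 3" by (simp add: power2_eq_square power3_eq_cube algebra_simps)
      then show ?thesis using False by simp
    qed
    finally show ?thesis using False by (simp add: mult_le_cancel_right)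
  qed
  then show ?thesis using exp_ge_add_one_self[of u] zero_le_power2[of u] by linarith
qed

context prob_space
begin

lemma expectation_exp_pos:
  assumes "bdd_measurable M X"
  shows "0 < expectation (\<lambda>x. exp (X x))"
proof -
  obtain C where C: "\<And>x. x \<in> space M \<Longrightarrow> \<bar>X x\<bar> \<le> C"
    using bdd_measurable_bound[OF assms] by blast
  have "0 < expectation (\<lambda>_. exp (- C))" by (simp add: prob_space)
  also have "\<dots> \<le> expectation (\<lambda>x. exp (X x))"
    using C by (intro expectation_mono_bdd bm_intros assms) (auto simp: abs_le_iff minus_le_iff)
  finally show ?thesis .
qed

lemma mgf_has_derivative:
  assumes X: "bdd_measurable M X"
  shows "((\<lambda>s. expectation (\<lambda>x. exp (s * X x))) has_real_derivative
    expectation (\<lambda>x. X x * exp (s * X x))) (at s)"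
proof -
  let ?m = "\<lambda>s. expectation (\<lambda>x. exp (s * X x))" and ?d = "expectation (\<lambda>x. X x * exp (s * X x))"
  obtain C where C: "0 < C" "\<And>x. x \<in> space M \<Longrightarrow> \<bar>X x\<bar> \<le> C"
    using bdd_measurable_bound[OF X] by blast
  note int = integrable_bdd_measurable bm_intros X
  have bound: "norm ((?m (s + h) - ?m s) / h - ?d) \<le> ?m s * C\<^sup>2 * \<bar>h\<bar>" if h: "h \<noteq> 0" "\<bar>h\<bar> < 1 / C" for h
  proof -
    have "\<bar>?m (s + h) - ?m s - h * ?d\<bar>
        = \<bar>expectation (\<lambda>x. exp ((s + h) * X x) - exp (s * X x) - h * (X x * exp (s * X x)))\<bar>"
      by (simp add: int)
    also have "\<dots> \<le> expectation (\<lambda>x. \<bar>exp ((s + h) * X x) - exp (s * X x) - h * (X x * exp (s * X x))\<bar>)"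
      by (rule integral_abs_bound)
    also have "\<dots> \<le> expectation (\<lambda>x. exp (s * X x) * (h\<^sup>2 * C\<^sup>2))"
    proof (intro expectation_mono_bdd bm_intros X)
      fix x assume x: "x \<in> space M"
      have "\<bar>h * X x\<bar> \<le> \<bar>h\<bar> * C"
        unfolding abs_mult by (intro mult_left_mono C(2) x abs_ge_zero)
      moreover have "\<bar>h\<bar> * C \<le> 1" using h C(1) by (simp add: field_simps)
      ultimately have hX: "\<bar>h * X x\<bar> \<le> 1" "\<bar>h * X x\<bar> \<le> \<bar>h\<bar> * C" by linarith+
      have eq: "exp ((s + h) * X x) - exp (s * X x) - h * (X x * exp (s * X x))
          = exp (s * X x) * (exp (h * X x) - 1 - h * X x)"
        by (simp add: algebra_simps exp_add)
      have "\<bar>exp (h * X x) - 1 - h * X x\<bar> \<le> (h * X x)\<^sup>2"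
        by (rule exp_second_order_remainder[OF hX(1)])
      also have "\<dots> \<le> (\<bar>h\<bar> * C)\<^sup>2"
        using hX(2) by (metis abs_ge_zero power2_abs power_mono)
      also have "\<dots> = h\<^sup>2 * C\<^sup>2" by (simp add: power_mult_distrib)
      finally show "\<bar>exp ((s + h) * X x) - exp (s * X x) - h * (X x * exp (s * X x))\<bar>
          \<le> exp (s * X x) * (h\<^sup>2 * C\<^sup>2)"
        unfolding eq abs_mult by (simp add: mult_left_mono)
    qed
    also have "\<dots> = ?m s * (h\<^sup>2 * C\<^sup>2)" by simp
    finally have *: "\<bar>?m (s + h) - ?m s - h * ?d\<bar> \<le> ?m s * (h\<^sup>2 * C\<^sup>2)" .
    have "\<bar>(?m (s + h) - ?m s) / h - ?d\<bar> = \<bar>?m (s + h) - ?m s - h * ?d\<bar> / \<bar>h\<bar>"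
      using h(1) by (simp add: field_simps flip: abs_divide)
    also have "\<dots> \<le> ?m s * (h\<^sup>2 * C\<^sup>2) / \<bar>h\<bar>"
      using * by (rule divide_right_mono) simp
    also have "\<dots> = ?m s * C\<^sup>2 * \<bar>h\<bar>"
      using h(1) by (auto simp: power2_eq_square field_simps abs_if)
    finally show ?thesis by simp
  qed
  have "((\<lambda>h. (?m (s + h) - ?m s) / h - ?d) \<longlongrightarrow> 0) (at 0)"
  proof (rule Lim_null_comparison)
    show "\<forall>\<^sub>F h in at 0. norm ((?m (s + h) - ?m s) / h - ?d) \<le> ?m s * C\<^sup>2 * \<bar>h\<bar>"
      unfolding eventually_at using C(1) bound by (intro exI[of _ "1 / C"]) (auto simp: dist_real_def)
    show "((\<lambda>h. ?m s * C\<^sup>2 * \<bar>h\<bar>) \<longlongrightarrow> 0) (at 0)"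
      by (auto intro!: tendsto_eq_intros)
  qed
  then show ?thesis
    unfolding DERIV_def by (rule LIM_zero_cancel)
qed

text \<open>
  Herbst's argument: the derivative of \<open>ln E(e\<^bsup>sX\<^esup>) / s\<close> is \<open>Ent(e\<^bsup>sX\<^esup>) / (s\<^sup>2 E(e\<^bsup>sX\<^esup>))\<close>, which is
  at most that of \<open>G\<close>, and the quotient tends to \<open>E X\<close> as \<open>s\<close> tends to 0. The primitive \<open>G\<close> may
  involve \<open>X\<close> itself; this is used for self-bounding functions.
\<close>

lemma Herbst:
  assumes X: "bdd_measurable M X" and t: "0 < t"
    and G: "\<And>s. 0 < s \<Longrightarrow> s \<le> t \<Longrightarrow> (G has_real_derivative g s) (at s)" "isCont G 0"
    and ent: "\<And>s. 0 < s \<Longrightarrow> s \<le> t \<Longrightarrow>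
      exp_entropy (\<lambda>x. s * X x) \<le> s\<^sup>2 * g s * expectation (\<lambda>x. exp (s * X x))"
  shows "ln (expectation (\<lambda>x. exp (t * X x))) \<le> t * (expectation X + G t - G 0)"
proof -
  let ?m = "\<lambda>s. expectation (\<lambda>x. exp (s * X x))" and ?d = "\<lambda>s. expectation (\<lambda>x. X x * exp (s * X x))"
  let ?\<phi> = "\<lambda>s. ln (?m s) / s - G s"
  have pos: "0 < ?m s" for s by (intro expectation_exp_pos bm_intros X)
  have dln: "((\<lambda>s. ln (?m s)) has_real_derivative ?d s / ?m s) (at s)" for s
    using DERIV_chain2[OF DERIV_ln_divide[OF pos[of s]] mgf_has_derivative[OF X]] by simp
  have mono: "?\<phi> t \<le> ?\<phi> r" if r: "0 < r" "r \<le> t" for r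
  proof (rule DERIV_nonpos_imp_nonincreasing[OF r(2)])
    fix s assume s: "r \<le> s" "s \<le> t"
    then have s0: "0 < s" using r by simp
    have "(?\<phi> has_real_derivative ((?d s / ?m s) * s - ln (?m s) * 1) / (s * s) - g s) (at s)"
      using s0 s(2) by (intro DERIV_diff DERIV_divide dln G(1) DERIV_ident) auto
    moreover have "((?d s / ?m s) * s - ln (?m s) * 1) / (s * s) - g s \<le> 0"
    proof -
      have "exp_entropy (\<lambda>x. s * X x) = s * ?d s - ?m s * ln (?m s)"
        by (simp add: exp_entropy_def mult_ac)
      then have "s * ?d s - ?m s * ln (?m s) \<le> s\<^sup>2 * g s * ?m s"
        using ent[OF s0 s(2)] by simp
      then have "(s * ?d s - ?m s * ln (?m s)) / (?m s * (s * s)) \<le> s\<^sup>2 * g s * ?m s / (?m s * (s * s))"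
        using pos[of s] s0 by (intro divide_right_mono) auto
      also have "\<dots> = g s" using pos[of s] s0 by (simp add: power2_eq_square)
      also have "(s * ?d s - ?m s * ln (?m s)) / (?m s * (s * s)) = ((?d s / ?m s) * s - ln (?m s) * 1) / (s * s)"
        using pos[of s] s0 by (simp add: field_simps)
      finally show ?thesis by simp
    qed
    ultimately show "\<exists>y. (?\<phi> has_real_derivative y) (at s) \<and> y \<le> 0" by blast
  qed
  have "((\<lambda>h. (ln (?m (0 + h)) - ln (?m 0)) / h) \<longlongrightarrow> ?d 0 / ?m 0) (at 0)"
    using dln[of 0] unfolding DERIV_def .
  then have "((\<lambda>h. ln (?m h) / h) \<longlongrightarrow> expectation X) (at_right 0)"
    by (simp add: prob_space filterlim_at_split)
  moreover have "(G \<longlongrightarrow> G 0) (at_right 0)"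
    using G(2) by (simp add: isCont_def filterlim_at_split)
  ultimately have "(?\<phi> \<longlongrightarrow> expectation X - G 0) (at_right 0)"
    by (rule tendsto_diff)
  moreover have "\<forall>\<^sub>F r in at_right 0. ?\<phi> t \<le> ?\<phi> r"
    unfolding eventually_at_right_field using t mono by (intro exI[of _ t]) auto
  ultimately have "?\<phi> t \<le> expectation X - G 0"
    by (intro tendsto_lowerbound[where F = "at_right 0"]) auto
  then show ?thesis using t by (simp add: field_simps)
qed

text \<open>
  One half of the Donsker-Varadhan formula: the difference of the two sides is \<open>E e\<^sup>F\<close> times
  the relative entropy of the normalised densities.
\<close>

lemma entropy_duality:
  assumes F: "bdd_measurable M F" and U: "bdd_measurable M U"
  shows "expectation (\<lambda>x. exp (F x) * U x)
    \<le> exp_entropy F + expectation (\<lambda>x. exp (F x)) * ln (expectation (\<lambda>x. exp (U x)))"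
proof -
  let ?Z = "expectation (\<lambda>x. exp (F x))" and ?A = "expectation (\<lambda>x. exp (U x))"
  have Z: "0 < ?Z" and A: "0 < ?A" by (auto intro!: expectation_exp_pos F U)
  note int = integrable_bdd_measurable bm_intros F U
  have "expectation (\<lambda>x. exp (F x) * U x - exp (F x) * ln ?A - exp (F x) * F x + exp (F x) * ln ?Z)
      \<le> expectation (\<lambda>x. exp (U x) * (?Z / ?A) - exp (F x))"
  proof (intro expectation_mono_bdd bm_intros F U)
    fix x
    let ?w = "U x - ln ?A - F x + ln ?Z"
    have "exp (F x) * (1 + ?w) \<le> exp (F x) * exp ?w"
      by (intro mult_left_mono exp_ge_add_one_self) auto
    also have "\<dots> = exp (U x) * (?Z / ?A)"
      using Z A by (simp add: exp_diff exp_add)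
    finally show "exp (F x) * U x - exp (F x) * ln ?A - exp (F x) * F x + exp (F x) * ln ?Z
        \<le> exp (U x) * (?Z / ?A) - exp (F x)"
      by (simp add: algebra_simps)
  qed
  also have "\<dots> = 0" using Z A by (simp add: int)
  finally show ?thesis by (simp add: int exp_entropy_def)
qed

text \<open>
  With \<open>L(s) = ln E(e\<^bsup>sW\<^esup>)\<close> the hypothesis is a bound of \<open>Ent(e\<^bsup>sW\<^esup>)\<close> by \<open>16 s\<^sup>2 L'(s) E(e\<^bsup>sW\<^esup>)\<close>. Hence \<open>Herbst\<close>
  applies with \<open>G = 16 L\<close> and gives \<open>L(t) \<le> t (1 + 16 L(t))\<close>.
\<close>

lemma mgf_self_bounding:
  assumes W: "bdd_measurable M W" and mean: "expectation W \<le> 1" and t: "0 < t" "t < 1 / 16"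
    and ent: "\<And>s. 0 < s \<Longrightarrow>
      exp_entropy (\<lambda>x. s * W x) \<le> 16 * s\<^sup>2 * expectation (\<lambda>x. exp (s * W x) * W x)"
  shows "ln (expectation (\<lambda>x. exp (t * W x))) \<le> t / (1 - 16 * t)"
proof -
  let ?m = "\<lambda>s. expectation (\<lambda>x. exp (s * W x))" and ?d = "\<lambda>s. expectation (\<lambda>x. W x * exp (s * W x))"
  have pos: "0 < ?m s" for s by (intro expectation_exp_pos bm_intros W)
  have dG: "((\<lambda>s. 16 * ln (?m s)) has_real_derivative 16 * (?d s / ?m s)) (at s)" for s
    using DERIV_cmult[OF DERIV_chain2[OF DERIV_ln_divide[OF pos[of s]] mgf_has_derivative[OF W]], of 16] by simp
  have "ln (?m t) \<le> t * (expectation W + 16 * ln (?m t) - 16 * ln (?m 0))"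
  proof (rule Herbst[OF W t(1)])
    show "((\<lambda>s. 16 * ln (?m s)) has_real_derivative 16 * (?d s / ?m s)) (at s)" for s
      by (rule dG)
    show "isCont (\<lambda>s. 16 * ln (?m s)) 0" by (rule DERIV_isCont[OF dG])
    show "exp_entropy (\<lambda>x. s * W x) \<le> s\<^sup>2 * (16 * (?d s / ?m s)) * ?m s" if "0 < s" for s
      using ent[OF that] pos[of s] by (simp add: mult_ac)
  qed
  also have "\<dots> \<le> t * (1 + 16 * ln (?m t))"
    using mean t by (intro mult_left_mono) (auto simp: prob_space)
  finally have "ln (?m t) * (1 - 16 * t) \<le> t" by (simp add: algebra_simps)
  then show ?thesis using t by (simp add: pos_le_divide_eq)
qed

text \<open>
  Here \<open>W\<close> plays the role of the squared gradient of \<open>X\<close>. Duality with the function \<open>\<theta> W\<close> bounds \<open>E(W e\<^bsup>sX\<^esup>)\<close> by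
  \<open>Ent(e\<^bsup>sX\<^esup>) / \<theta>\<close> plus an exponential moment of \<open>W\<close>, and the entropy can be
  absorbed into the left side when \<open>s\<^sup>2 < \<theta>\<close>. The choice \<open>\<theta> = s / 4\<close> makes the factors \<open>1 - 16 \<theta>\<close> and
  \<open>1 - s\<^sup>2 / \<theta>\<close> equal and leads to \<open>Ent(e\<^bsup>sX\<^esup>) \<le> s\<^sup>2 (1 - 4 s)\<^sup>-\<^sup>2 E(e\<^bsup>sX\<^esup>)\<close>.
\<close>

lemma mgf_second_order:
  assumes X: "bdd_measurable M X" and W: "bdd_measurable M W" and mean: "expectation X = 0"
    and mgfW: "\<And>t. 0 < t \<Longrightarrow> t < 1 / 16 \<Longrightarrow> ln (expectation (\<lambda>x. exp (t * W x))) \<le> t / (1 - 16 * t)"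
    and ent: "\<And>s. 0 < s \<Longrightarrow> exp_entropy (\<lambda>x. s * X x) \<le> s\<^sup>2 * expectation (\<lambda>x. exp (s * X x) * W x)"
  shows "expectation (\<lambda>x. exp (X x / 5)) \<le> exp (1 / 5)"
proof -
  let ?m = "\<lambda>s. expectation (\<lambda>x. exp (s * X x))"
  have pos: "0 < ?m s" for s by (intro expectation_exp_pos bm_intros X)
  have bound: "exp_entropy (\<lambda>x. s * X x) \<le> s\<^sup>2 * (1 / (1 - 4 * s)\<^sup>2) * ?m s" if s: "0 < s" "s \<le> 1 / 5" for s
  proof -
    let ?H = "exp_entropy (\<lambda>x. s * X x)"
    have "expectation (\<lambda>x. exp (s * X x) * (s / 4 * W x))
        \<le> ?H + ?m s * ln (expectation (\<lambda>x. exp (s / 4 * W x)))"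
      by (intro entropy_duality bm_intros X W)
    also have "\<dots> \<le> ?H + ?m s * ((s / 4) / (1 - 16 * (s / 4)))"
      using pos[of s] s by (intro add_left_mono mult_left_mono mgfW) auto
    also have "expectation (\<lambda>x. exp (s * X x) * (s / 4 * W x)) = s / 4 * expectation (\<lambda>x. exp (s * X x) * W x)"
      by (simp add: mult.left_commute)
    finally have "4 * s * (s / 4 * expectation (\<lambda>x. exp (s * X x) * W x))
        \<le> 4 * s * (?H + ?m s * ((s / 4) / (1 - 4 * s)))"
      using s by (intro mult_left_mono) auto
    moreover have "4 * s * (s / 4 * p) = s\<^sup>2 * p" "4 * s * (q + r * (s / 4 / d)) = 4 * s * q + r * (s\<^sup>2 / d)"
      for p q r d by (simp_all add: power2_eq_square algebra_simps)
    ultimately have "s\<^sup>2 * expectation (\<lambda>x. exp (s * X x) * W x) \<le> 4 * s * ?H + ?m s * (s\<^sup>2 / (1 - 4 * s))"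
      by (simp only:)
    then have "?H * (1 - 4 * s) \<le> ?m s * (s\<^sup>2 / (1 - 4 * s))"
      using ent[OF s(1)] by (simp add: algebra_simps)
    then have "?H \<le> ?m s * (s\<^sup>2 / (1 - 4 * s)) / (1 - 4 * s)"
      using s by (simp add: pos_le_divide_eq)
    then show ?thesis by (simp add: power2_eq_square mult_ac)
  qed
  have "ln (?m (1/5)) \<le> 1/5 * (expectation X + (1/5) / (1 - 4 * (1/5)) - 0 / (1 - 4 * 0))"
  proof (rule Herbst[where G = "\<lambda>s. s / (1 - 4 * s)", OF X _ _ _ bound])
    fix s :: real assume "0 < s" "s \<le> 1/5"
    then show "((\<lambda>s. s / (1 - 4 * s)) has_real_derivative 1 / (1 - 4 * s)\<^sup>2) (at s)"
      by (auto intro!: derivative_eq_intros simp: power2_eq_square field_simps)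
  qed (auto intro!: continuous_intros)
  then have "ln (?m (1/5)) \<le> 1/5" using mean by simp
  then have "?m (1/5) \<le> exp (1/5)" using pos[of "1/5"] by (metis exp_le_cancel_iff exp_ln)
  then show ?thesis by simp
qed

text \<open>
  Passing to the power \<open>5/7\<close> turns the bound \<open>2 e\<^bsup>1/5\<^esup>\<close> for \<open>E exp(|X| / 5)\<close> into a bound for
  \<open>E exp(|X| / 7)\<close>. The result is at most 2 because \<open>2 e\<^bsup>1/5\<^esup> \<le> 2\<^bsup>7/5\<^esup>\<close>, that is \<open>e \<le> 4\<close>. Jensen's inequality
  for the power takes the form of the tangent at \<open>2\<^bsup>7/5\<^esup> = e\<^sup>a\<close>.
\<close>

lemma exp_abs_moment_le_2:
  assumes X: "bdd_measurable M X"
    and "expectation (\<lambda>x. exp (X x / 5)) \<le> exp (1 / 5)" "expectation (\<lambda>x. exp (- X x / 5)) \<le> exp (1 / 5)"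
  shows "expectation (\<lambda>x. exp (\<bar>X x\<bar> / 7)) \<le> 2"
proof -
  define a where "a = 7 / 5 * ln (2::real)"
  have "expectation (\<lambda>x. exp (\<bar>X x\<bar> / 7))
      \<le> expectation (\<lambda>x. 2 * (2 / 7 + 5 / 7 * (exp (- a) * (exp (X x / 5) + exp (- X x / 5)))))"
  proof (intro expectation_mono_bdd bm_intros X)
    fix x
    have "exp (\<bar>X x\<bar> / 7) = exp (ln 2 + (5 / 7 * (\<bar>X x\<bar> / 5 - a) + 2 / 7 * 0))"
      by (simp add: a_def field_simps)
    also have "\<dots> = 2 * exp (5 / 7 * (\<bar>X x\<bar> / 5 - a) + 2 / 7 * 0)" by (subst exp_add) simp
    also have "\<dots> \<le> 2 * (5 / 7 * exp (\<bar>X x\<bar> / 5 - a) + 2 / 7 * exp 0)"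
      using convex_onD[OF exp_convex, of "2/7" "\<bar>X x\<bar> / 5 - a" 0] by (intro mult_left_mono) auto
    also have "exp (\<bar>X x\<bar> / 5 - a) = exp (- a) * exp (\<bar>X x\<bar> / 5)"
      by (simp flip: exp_add)
    also have "exp (\<bar>X x\<bar> / 5) \<le> exp (X x / 5) + exp (- X x / 5)"
      by (cases "0 \<le> X x") auto
    finally show "exp (\<bar>X x\<bar> / 7) \<le> 2 * (2 / 7 + 5 / 7 * (exp (- a) * (exp (X x / 5) + exp (- X x / 5))))"
      by simp
  qed
  also have "\<dots> = 2 * (2 / 7 + 5 / 7 * (exp (- a) *
      (expectation (\<lambda>x. exp (X x / 5)) + expectation (\<lambda>x. exp (- X x / 5)))))"
    by (simp add: integrable_bdd_measurable bm_intros X prob_space)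
  also have "\<dots> \<le> 2 * (2 / 7 + 5 / 7 * (exp (- a) * (2 * exp (1 / 5))))"
    using assms(2,3) by (intro mult_left_mono add_left_mono) auto
  also have "exp (- a) * (2 * exp (1 / 5)) = exp (1 / 5 - 2 / 5 * ln 2)"
  proof -
    have "exp (- a) * (2 * exp (1 / 5)) = exp (- a) * (exp (ln 2) * exp (1 / 5))" by simp
    also have "\<dots> = exp (- a + (ln 2 + 1 / 5))" by (simp only: exp_add)
    also have "- a + (ln 2 + 1 / 5) = 1 / 5 - 2 / 5 * ln 2" by (simp add: a_def)
    finally show ?thesis .
  qed
  also have "exp (1 / 5 - 2 / 5 * ln 2) \<le> (1::real)"
    using ln2_ge_two_thirds by simp
  finally show ?thesis by simp
qed

end

section \<open>First and second differences\<close>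

lemma (in prob_space) expectation_Cauchy_Schwarz:
  assumes u: "bdd_measurable M u" and w: "bdd_measurable M w"
  shows "expectation (\<lambda>x. u x * w x) \<le> sqrt (expectation (\<lambda>x. (u x)\<^sup>2)) * sqrt (expectation (\<lambda>x. (w x)\<^sup>2))"
proof -
  let ?A = "expectation (\<lambda>x. (u x)\<^sup>2)" and ?B = "expectation (\<lambda>x. (w x)\<^sup>2)" and ?C = "expectation (\<lambda>x. u x * w x)"
  note int = integrable_bdd_measurable bm_intros u w
  have A: "0 \<le> ?A" and B: "0 \<le> ?B" by (auto intro!: integral_nonneg_AE)
  show ?thesis
  proof (cases "?A = 0 \<or> ?B = 0")
    case True
    then have "(AE x in M. (u x)\<^sup>2 = 0) \<or> (AE x in M. (w x)\<^sup>2 = 0)"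
      by (subst (asm) (1 2) integral_nonneg_eq_0_iff_AE) (auto intro!: int)
    then have "AE x in M. u x * w x = 0" by auto
    then have "?C = 0" by (rule integral_eq_zero_AE)
    then show ?thesis using A B by simp
  next
    case False
    let ?a = "sqrt ?A" and ?b = "sqrt ?B"
    have ab: "0 < ?a" "0 < ?b" using False A B by (simp_all add: less_le)
    have "0 \<le> expectation (\<lambda>x. (?b * u x - ?a * w x)\<^sup>2)" by (intro integral_nonneg_AE) auto
    also have "\<dots> = expectation (\<lambda>x. ?b\<^sup>2 * (u x)\<^sup>2 - 2 * ?a * ?b * (u x * w x) + ?a\<^sup>2 * (w x)\<^sup>2)"
      by (intro Bochner_Integration.integral_cong refl) (simp add: power2_eq_square algebra_simps)
    also have "\<dots> = ?b\<^sup>2 * ?A - 2 * ?a * ?b * ?C + ?a\<^sup>2 * ?B"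
      by (simp add: int)
    also have "\<dots> = 2 * (?a * ?b) * (?a * ?b - ?C)"
      using A B by (simp add: power2_eq_square algebra_simps flip: real_sqrt_mult)
    finally show ?thesis using mult_pos_pos[OF ab] by (auto simp: zero_le_mult_iff)
  qed
qed

text \<open>
  The reverse triangle inequality in \<open>L\<^sup>2\<close>, normalised as in the definition of the difference operators.
\<close>

lemma (in prob_space) L2_norm_difference:
  assumes u: "bdd_measurable M u" and w: "bdd_measurable M w"
  shows "(sqrt (1/2 * expectation (\<lambda>x. (u x)\<^sup>2)) - sqrt (1/2 * expectation (\<lambda>x. (w x)\<^sup>2)))\<^sup>2
    \<le> 1/2 * expectation (\<lambda>x. (u x - w x)\<^sup>2)"
proof -
  let ?A = "expectation (\<lambda>x. (u x)\<^sup>2)" and ?B = "expectation (\<lambda>x. (w x)\<^sup>2)"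
  note int = integrable_bdd_measurable bm_intros u w
  have A: "0 \<le> ?A" and B: "0 \<le> ?B" by (auto intro!: integral_nonneg_AE)
  have "(sqrt (1/2 * ?A) - sqrt (1/2 * ?B))\<^sup>2 = 1/2 * (?A + ?B) - sqrt ?A * sqrt ?B"
    using A B by (simp add: power2_diff real_sqrt_divide field_simps)
  also have "\<dots> \<le> 1/2 * (?A + ?B) - expectation (\<lambda>x. u x * w x)"
    using expectation_Cauchy_Schwarz[OF u w] by simp
  also have "\<dots> = expectation (\<lambda>x. 1/2 * (u x)\<^sup>2 + 1/2 * (w x)\<^sup>2 - u x * w x)"
    by (simp add: int)
  also have "\<dots> = expectation (\<lambda>x. 1/2 * (u x - w x)\<^sup>2)"
    by (intro Bochner_Integration.integral_cong refl) (simp add: power2_eq_square field_simps)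
  finally show ?thesis by simp
qed

text \<open>
  For vectors \<open>a\<close> and \<open>b\<close>, \<open>|a|\<^sup>2 - |b|\<^sup>2 \<le> 2 \<langle>a, a - b\<rangle>\<close>. In the scalar product, Cauchy-Schwarz is applied to
  the entries \<open>j \<noteq> i\<close> only. The entry \<open>i\<close> contributes \<open>a\<^sub>i (a\<^sub>i - b\<^sub>i) \<le> a\<^sub>i B\<close>; the squares of these
  contributions sum over \<open>i\<close> to \<open>|a|\<^sup>2 B\<^sup>2\<close>.
\<close>

lemma sum_of_squares_difference:
  fixes a b d :: "'j \<Rightarrow> real"
  assumes J: "finite J" and i: "i \<in> J" and nonneg: "\<And>j. j \<in> J \<Longrightarrow> 0 \<le> a j" "\<And>j. j \<in> J \<Longrightarrow> 0 \<le> b j"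
    and ai: "a i \<le> B" and d: "\<And>j. j \<in> J - {i} \<Longrightarrow> (a j - b j)\<^sup>2 \<le> d j"
  shows "(max 0 ((\<Sum>j\<in>J. (a j)\<^sup>2) - (\<Sum>j\<in>J. (b j)\<^sup>2)))\<^sup>2
    \<le> 8 * ((\<Sum>j\<in>J. (a j)\<^sup>2) * (\<Sum>j\<in>J - {i}. d j) + (a i)\<^sup>2 * B\<^sup>2)"
proof -
  let ?S = "\<Sum>j\<in>J - {i}. a j * (a j - b j)"
  let ?V = "\<Sum>j\<in>J. (a j)\<^sup>2"
  have "?V - (\<Sum>j\<in>J. (b j)\<^sup>2) \<le> 2 * (?S + a i * B)"
  proof -
    have "?V - (\<Sum>j\<in>J. (b j)\<^sup>2) = (\<Sum>j\<in>J. (a j)\<^sup>2 - (b j)\<^sup>2)" by (simp add: sum_subtractf)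
    also have "\<dots> \<le> (\<Sum>j\<in>J. 2 * (a j * (a j - b j)))"
    proof (rule sum_mono)
      show "(a j)\<^sup>2 - (b j)\<^sup>2 \<le> 2 * (a j * (a j - b j))" for j
        using zero_le_power2[of "a j - b j"] by (simp add: power2_eq_square algebra_simps)
    qed
    also have "\<dots> = 2 * (a i * (a i - b i) + ?S)"
      using J i by (simp add: sum.remove[of J i] flip: sum_distrib_left)
    also have "a i * (a i - b i) \<le> a i * B"
      using nonneg[OF i] ai by (intro mult_left_mono) auto
    finally show ?thesis by simp
  qed
  then have "max 0 (?V - (\<Sum>j\<in>J. (b j)\<^sup>2)) \<le> \<bar>2 * (?S + a i * B)\<bar>" by simp
  then have "(max 0 (?V - (\<Sum>j\<in>J. (b j)\<^sup>2)))\<^sup>2 \<le> \<bar>2 * (?S + a i * B)\<bar>\<^sup>2"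
    by (intro power_mono) auto
  also have "\<dots> = 4 * (?S + a i * B)\<^sup>2" by (simp only: power2_abs power_mult_distrib) simp
  also have "(?S + a i * B)\<^sup>2 \<le> 2 * ?S\<^sup>2 + 2 * (a i * B)\<^sup>2"
    using zero_le_power2[of "?S - a i * B"] by (simp add: power2_sum power2_diff)
  also have "?S\<^sup>2 \<le> (\<Sum>j\<in>J - {i}. (a j)\<^sup>2) * (\<Sum>j\<in>J - {i}. (a j - b j)\<^sup>2)"
    by (rule Cauchy_Schwarz_ineq_sum)
  also have "\<dots> \<le> ?V * (\<Sum>j\<in>J - {i}. d j)"
    using J by (intro mult_mono sum_mono2 sum_mono d sum_nonneg) auto
  finally show ?thesis by (simp add: power_mult_distrib algebra_simps)
qed

context finite_probability_product
begin

text \<open>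
  The squares of the difference operators, over an arbitrary index type.
\<close>

definition sq_diff1 :: "'i \<Rightarrow> (('i \<Rightarrow> 'a) \<Rightarrow> real) \<Rightarrow> ('i \<Rightarrow> 'a) \<Rightarrow> real" where
  "sq_diff1 i f x = 1/2 * (\<integral>y. (f x - f (x(i := y)))\<^sup>2 \<partial>M i)"

definition sq_diff2 :: "'i \<Rightarrow> 'i \<Rightarrow> (('i \<Rightarrow> 'a) \<Rightarrow> real) \<Rightarrow> ('i \<Rightarrow> 'a) \<Rightarrow> real" where
  "sq_diff2 i j f x = 1/4 * (\<integral>y. (\<integral>z.
      (f x - f (x(i := y)) - f (x(j := z)) + f (x(i := y, j := z)))\<^sup>2 \<partial>M j) \<partial>M i)"

lemma sq_diff1_nonneg: "0 \<le> sq_diff1 i f x"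
  unfolding sq_diff1_def by (intro mult_nonneg_nonneg integral_nonneg_AE) auto

lemma sq_diff2_nonneg: "0 \<le> sq_diff2 i j f x"
  unfolding sq_diff2_def by (intro mult_nonneg_nonneg integral_nonneg_AE) auto

lemma bm_sq_diff1 [bm_intros]:
  assumes f: "bm f" and i: "i \<in> I"
  shows "bm (sq_diff1 i f)"
  unfolding sq_diff1_def
  by (intro bm_intros bdd_measurable_integral prob_factor
      bdd_measurable_update[OF f] bdd_measurable_compose[OF f] i) auto

lemma bm_sq_diff2:
  assumes f: "bm f" and i: "i \<in> I" and j: "j \<in> I"
  shows "bm (sq_diff2 i j f)"
  unfolding sq_diff2_def
  by (intro bm_intros bdd_measurable_integral prob_factor update_measurable
      bdd_measurable_update[OF f] bdd_measurable_compose[OF f] i j) auto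

lemma sq_diff1_expand:
  assumes f: "bm f" and i: "i \<in> I" and x: "x \<in> space (Pi\<^sub>M I M)"
  shows "sq_diff1 i f x = 1/2 * ((f x)\<^sup>2 - 2 * (f x * average i f x) + average i (\<lambda>x. (f x)\<^sup>2) x)"
proof -
  interpret Mi: prob_space "M i" using i by (rule prob_factor)
  note int = Mi.integrable_bdd_measurable bm_intros bdd_measurable_section[OF f i x]
  show ?thesis
    unfolding sq_diff1_def average_def by (simp add: power2_diff int Mi.prob_space)
qed

lemma expectation_mult_average:
  assumes f: "bm f" and i: "i \<in> I"
  shows "expectation (\<lambda>x. f x * average i f x) = expectation (\<lambda>x. (average i f x)\<^sup>2)"
  using expectation_average_mult[OF i f bm_average[OF f i] average_ignores]
  by (simp add: power2_eq_square)

lemma expectation_sq_diff1: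
  assumes f: "bm f" and i: "i \<in> I"
  shows "expectation (sq_diff1 i f) = expectation (\<lambda>x. (f x)\<^sup>2) - expectation (\<lambda>x. (average i f x)\<^sup>2)"
proof -
  have "expectation (sq_diff1 i f)
    = expectation (\<lambda>x. 1/2 * ((f x)\<^sup>2 - 2 * (f x * average i f x) + average i (\<lambda>x. (f x)\<^sup>2) x))"
    by (intro Bochner_Integration.integral_cong sq_diff1_expand f i refl)
  also have "\<dots> = 1/2 * (expectation (\<lambda>x. (f x)\<^sup>2) - 2 * expectation (\<lambda>x. f x * average i f x)
      + expectation (average i (\<lambda>x. (f x)\<^sup>2)))"
    by (simp add: integrable_bdd_measurable bm_intros f i)
  finally show ?thesis
    using expectation_mult_average[OF f i] expectation_average[OF i, of "\<lambda>x. (f x)\<^sup>2"]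
    by (simp add: bm_intros f)
qed

text \<open>
  The first difference and the residual \<open>f - E\<^sub>i f\<close> have the same second moment: both give the mean
  conditional variance in coordinate \<open>i\<close>.
\<close>

lemma expectation_sq_diff1_residual:
  assumes f: "bm f" and i: "i \<in> I"
  shows "expectation (sq_diff1 i f) = expectation (\<lambda>x. (f x - average i f x)\<^sup>2)"
proof -
  have "expectation (\<lambda>x. (f x - average i f x)\<^sup>2)
      = expectation (\<lambda>x. (f x)\<^sup>2 + (average i f x)\<^sup>2 - 2 * (f x * average i f x))"
    by (simp add: power2_diff mult_ac)
  also have "\<dots> = expectation (\<lambda>x. (f x)\<^sup>2) + expectation (\<lambda>x. (average i f x)\<^sup>2)
      - 2 * expectation (\<lambda>x. f x * average i f x)"
    by (simp add: integrable_bdd_measurable bm_intros f i)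
  finally show ?thesis
    using expectation_mult_average[OF f i] expectation_sq_diff1[OF f i] by simp
qed

lemma expectation_square_average_le:
  assumes f: "bm f" and i: "i \<in> I"
  shows "expectation (\<lambda>x. (average i f x)\<^sup>2) \<le> expectation (\<lambda>x. (f x)\<^sup>2)"
proof -
  have "0 \<le> expectation (sq_diff1 i f)" by (intro integral_nonneg_AE) (auto simp: sq_diff1_nonneg)
  then show ?thesis using expectation_sq_diff1[OF f i] by simp
qed

text \<open>
  Averaging over another coordinate commutes with taking residuals and contracts \<open>L\<^sup>2\<close>.
\<close>

lemma expectation_sq_diff1_average_le:
  assumes f: "bm f" and ij: "i \<in> I" "j \<in> I" "i \<noteq> j"
  shows "expectation (sq_diff1 i (average j f)) \<le> expectation (sq_diff1 i f)"
proof -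
  have "expectation (sq_diff1 i (average j f)) = expectation (\<lambda>x. (average j f x - average i (average j f) x)\<^sup>2)"
    by (intro expectation_sq_diff1_residual bm_intros f ij)
  also have "\<dots> = expectation (\<lambda>x. (average j (\<lambda>x. f x - average i f x) x)\<^sup>2)"
    by (intro Bochner_Integration.integral_cong refl)
      (simp add: average_commute[OF f ij] average_diff f ij bm_intros)
  also have "\<dots> \<le> expectation (\<lambda>x. (f x - average i f x)\<^sup>2)"
    by (intro expectation_square_average_le bm_intros f ij)
  also have "\<dots> = expectation (sq_diff1 i f)"
    by (rule expectation_sq_diff1_residual[symmetric, OF f ij(1)])
  finally show ?thesis .
qed

lemma expectation_sq_diff1_averages_le:
  assumes "bm f" "i \<in> I"
  shows "set js \<subseteq> I \<Longrightarrow> i \<notin> set js \<Longrightarrow> expectation (sq_diff1 i (averages js f)) \<le> expectation (sq_diff1 i f)"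
proof (induction js)
  case (Cons j js)
  then have "expectation (sq_diff1 i (averages (j # js) f)) \<le> expectation (sq_diff1 i (averages js f))"
    using assms by (auto intro!: expectation_sq_diff1_average_le bm_averages)
  then show ?case using Cons by auto
qed simp

text \<open>
  Each averaging step lowers the second moment by the mean conditional variance in that coordinate.
  Integrating out only some of the coordinates gives the Efron-Stein inequality conditionally on the rest.
\<close>

lemma Efron_Stein:
  assumes f: "bm f"
  shows "set js \<subseteq> I \<Longrightarrow> distinct js \<Longrightarrow>
    expectation (\<lambda>x. (f x)\<^sup>2) - expectation (\<lambda>x. (averages js f x)\<^sup>2) \<le> (\<Sum>j\<in>set js. expectation (sq_diff1 j f))"
proof (induction js)
  case (Cons j js)
  have "expectation (\<lambda>x. (averages js f x)\<^sup>2) - expectation (\<lambda>x. (averages (j # js) f x)\<^sup>2)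
      = expectation (sq_diff1 j (averages js f))"
    using Cons.prems by (simp add: expectation_sq_diff1 bm_averages f)
  also have "\<dots> \<le> expectation (sq_diff1 j f)"
    using Cons.prems by (intro expectation_sq_diff1_averages_le f) auto
  finally show ?case using Cons by simp
qed simp

text \<open>
  For fixed \<open>y\<close>, the inner integral of the second difference is a first difference in \<open>z\<close> of
  \<open>k\<^sub>y(x) = f x - f (x(i := y))\<close>. Its mean is the second moment of \<open>k\<^sub>y - E\<^sub>j k\<^sub>y\<close>, which
  is the increment of \<open>f - E\<^sub>j f\<close> in coordinate \<open>i\<close>.
\<close>

lemma expectation_sq_diff2:
  assumes f: "bm f" and ij: "i \<in> I" "j \<in> I" "i \<noteq> j"
  shows "expectation (sq_diff2 i j f) = expectation (sq_diff1 i (\<lambda>x. f x - average j f x))"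
proof -
  interpret Mi: prob_space "M i" by (rule prob_factor) fact
  interpret Mj: prob_space "M j" by (rule prob_factor) fact
  let ?g = "\<lambda>x. f x - average j f x"
  let ?k = "\<lambda>y x. f x - f (x(i := y))"
  note meas = prob_factor ij update_measurable bm_intros bdd_measurable_update[OF f] bdd_measurable_compose[OF f]
  have eq: "sq_diff2 i j f = (\<lambda>x. 1/2 * (\<integral>y. sq_diff1 j (?k y) x \<partial>M i))"
    unfolding sq_diff2_def sq_diff1_def
    using ij by (intro ext) (simp add: fun_upd_twist algebra_simps)
  have bmk: "bm (?k y)" if "y \<in> space (M i)" for y
    using that by (intro meas) auto
  have avg: "average j (?k y) x = average j f x - average j f (x(i := y))"
    if x: "x \<in> space (Pi\<^sub>M I M)" and y: "y \<in> space (M i)" for x y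
  proof -
    have "bdd_measurable (M j) (\<lambda>z. f (x(i := y, j := z)))"
      by (intro bdd_measurable_section f ij update_in_space x y)
    then show ?thesis
      using bdd_measurable_section[OF f ij(2) x] ij(3)
      unfolding average_def by (simp add: Mj.integrable_bdd_measurable fun_upd_twist)
  qed
  have "expectation (sq_diff2 i j f) = 1/2 * expectation (\<lambda>x. \<integral>y. sq_diff1 j (?k y) x \<partial>M i)"
    unfolding eq by simp
  also have "expectation (\<lambda>x. \<integral>y. sq_diff1 j (?k y) x \<partial>M i) = (\<integral>y. expectation (sq_diff1 j (?k y)) \<partial>M i)"
    unfolding sq_diff1_def
    by (intro integral_swap_bdd prob_space_axioms bdd_measurable_integral meas) auto
  also have "\<dots> = (\<integral>y. expectation (\<lambda>x. (?g x - ?g (x(i := y)))\<^sup>2) \<partial>M i)"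
  proof (rule Bochner_Integration.integral_cong[OF refl])
    fix y assume y: "y \<in> space (M i)"
    have "expectation (sq_diff1 j (?k y)) = expectation (\<lambda>x. (?k y x - average j (?k y) x)\<^sup>2)"
      by (intro expectation_sq_diff1_residual bmk y ij)
    also have "\<dots> = expectation (\<lambda>x. (?g x - ?g (x(i := y)))\<^sup>2)"
      by (intro Bochner_Integration.integral_cong refl) (simp add: avg y algebra_simps)
    finally show "expectation (sq_diff1 j (?k y)) = expectation (\<lambda>x. (?g x - ?g (x(i := y)))\<^sup>2)" .
  qed
  also have "\<dots> = expectation (\<lambda>x. \<integral>y. (?g x - ?g (x(i := y)))\<^sup>2 \<partial>M i)"
  proof (rule integral_swap_bdd[symmetric, OF prob_space_axioms Mi.prob_space_axioms])
    have Pf: "bm (average j f)" by (intro bm_average f ij)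
    show "bdd_measurable (Pi\<^sub>M I M \<Otimes>\<^sub>M M i) (\<lambda>z. (?g (fst z) - ?g ((fst z)(i := snd z)))\<^sup>2)"
      by (intro bdd_measurable_power bdd_measurable_diff ij
          bdd_measurable_update[OF f] bdd_measurable_compose[OF f]
          bdd_measurable_update[OF Pf] bdd_measurable_compose[OF Pf]) auto
  qed
  also have "1/2 * \<dots> = expectation (sq_diff1 i ?g)" unfolding sq_diff1_def by simp
  finally show ?thesis .
qed

text \<open>
  The left side is the second moment of \<open>g = f - E\<^sub>j f\<close>. The conditional expectation \<open>r\<close> of \<open>g\<close>
  given the \<open>j\<close>-th coordinate vanishes almost everywhere, because \<open>E(r\<^sup>2) = E(g r)\<close> and \<open>f\<close> is orthogonal to all
  functions of that coordinate. The Efron-Stein inequality for \<open>g\<close> in the other coordinates therefore has no remainder.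
\<close>

lemma second_order_Efron_Stein:
  assumes f: "bm f" and j: "j \<in> I"
    and orth: "\<And>h. bm h \<Longrightarrow> (\<And>i. i \<in> I - {j} \<Longrightarrow> ignores h i) \<Longrightarrow> expectation (\<lambda>x. f x * h x) = 0"
  shows "expectation (sq_diff1 j f) \<le> (\<Sum>i\<in>I - {j}. expectation (sq_diff2 i j f))"
proof -
  let ?g = "\<lambda>x. f x - average j f x"
  obtain js where js: "set js = I - {j}" "distinct js"
    using finite_distinct_list[of "I - {j}"] finite_index by blast
  let ?r = "averages js ?g"
  have sub: "set js \<subseteq> I" using js by auto
  have g: "bm ?g" by (intro bm_intros f j)
  have r: "bm ?r" by (intro bm_averages g sub)
  have ign: "ignores ?r i" if "i \<in> I - {j}" for i
    using that js sub by (intro averages_ignores) auto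
  have "expectation (\<lambda>x. ?r x * ?r x) = expectation (\<lambda>x. ?g x * ?r x)"
    using js by (intro expectation_averages_mult sub g r ign) auto
  also have "\<dots> = expectation (\<lambda>x. f x * ?r x) - expectation (\<lambda>x. average j f x * ?r x)"
    by (simp add: left_diff_distrib integrable_bdd_measurable bm_intros f j r)
  also have "expectation (\<lambda>x. f x * ?r x) = 0" by (rule orth[OF r ign])
  also have "expectation (\<lambda>x. average j f x * ?r x) = expectation (\<lambda>x. average j f x * average j ?r x)"
    using expectation_average_mult[OF j r bm_average[OF f j] average_ignores] by (simp add: mult.commute)
  also have "\<dots> = expectation (\<lambda>x. f x * average j ?r x)"
    by (intro expectation_average_mult j f bm_average r average_ignores)
  also have "\<dots> = 0"
    by (intro orth bm_average r j average_preserves_ignores ign)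
  finally have "expectation (\<lambda>x. (?r x)\<^sup>2) = 0" by (simp add: power2_eq_square)
  then have "expectation (\<lambda>x. (?g x)\<^sup>2) \<le> (\<Sum>i\<in>set js. expectation (sq_diff1 i ?g))"
    using Efron_Stein[OF g sub js(2)] by simp
  also have "\<dots> = (\<Sum>i\<in>I - {j}. expectation (sq_diff2 i j f))"
    unfolding js(1) by (intro sum.cong refl expectation_sq_diff2[symmetric] f j) auto
  finally show ?thesis unfolding expectation_sq_diff1_residual[OF f j] .
qed

text \<open>
  The \<open>j\<close>-th first differences at \<open>x\<close> and at \<open>x(i := y)\<close> are \<open>L\<^sup>2\<close> norms of two functions of \<open>z\<close>
  whose difference is the integrand of the second difference.
\<close>

lemma sq_diff1_root_difference:
  assumes f: "bm f" and ij: "i \<in> I" "j \<in> I" "i \<noteq> j"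
    and x: "x \<in> space (Pi\<^sub>M I M)" and y: "y \<in> space (M i)"
  shows "(sqrt (sq_diff1 j f x) - sqrt (sq_diff1 j f (x(i := y))))\<^sup>2
    \<le> 1/2 * (\<integral>z. (f x - f (x(i := y)) - f (x(j := z)) + f (x(i := y, j := z)))\<^sup>2 \<partial>M j)"
proof -
  interpret Mj: prob_space "M j" by (rule prob_factor) fact
  have b: "bdd_measurable (M j) (\<lambda>z. f x - f (x(j := z)))"
    "bdd_measurable (M j) (\<lambda>z. f (x(i := y)) - f (x(i := y, j := z)))"
    using bdd_measurable_section[OF f ij(2) x] bdd_measurable_section[OF f ij(2) update_in_space[OF x ij(1) y]]
    by (auto intro: bm_intros)
  show ?thesis
    using Mj.L2_norm_difference[OF b] unfolding sq_diff1_def by (simp add: algebra_simps)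
qed

section \<open>Concentration in terms of second differences\<close>

definition gradient_sq :: "(('i \<Rightarrow> 'a) \<Rightarrow> real) \<Rightarrow> ('i \<Rightarrow> 'a) \<Rightarrow> real" where
  "gradient_sq f x = (\<Sum>i\<in>I. sq_diff1 i f x)"

lemma bm_gradient_sq: "bm f \<Longrightarrow> bm (gradient_sq f)"
  unfolding gradient_sq_def by (intro bm_intros)

text \<open>
  For each \<open>i\<close> and \<open>y\<close>, \<open>sum_of_squares_difference\<close> compares the vectors of first differences at \<open>x\<close> and at
  \<open>x(i := y)\<close>. Integration over \<open>y\<close> and summation over \<open>i\<close> give the factor \<open>8 (2 B1\<^sup>2 + B2\<^sup>2)\<close>, which is at most
  \<open>16 (B1 + B2)\<^sup>2\<close>.
\<close>

lemma gradient_sq_self_bounding: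
  assumes f: "bm f" and x: "x \<in> space (Pi\<^sub>M I M)" and B: "0 \<le> B1" "0 \<le> B2"
    and B1: "(\<Sum>i\<in>I. \<Sum>j\<in>I - {i}. sq_diff2 i j f x) \<le> B1\<^sup>2"
    and B2: "\<And>i. i \<in> I \<Longrightarrow> sqrt (sq_diff1 i f x) \<le> B2"
  shows "(\<Sum>i\<in>I. \<integral>y. (max 0 (gradient_sq f x - gradient_sq f (x(i := y))))\<^sup>2 \<partial>M i)
    \<le> 16 * (B1 + B2)\<^sup>2 * gradient_sq f x"
proof -
  let ?V = "gradient_sq f"
  let ?D = "\<lambda>i j y. 1/2 * (\<integral>z. (f x - f (x(i := y)) - f (x(j := z)) + f (x(i := y, j := z)))\<^sup>2 \<partial>M j)"
  have V: "bm ?V" by (rule bm_gradient_sq[OF f])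
  have V_root: "?V x = (\<Sum>j\<in>I. (sqrt (sq_diff1 j f x))\<^sup>2)" for x
    by (simp add: gradient_sq_def sq_diff1_nonneg)
  have V0: "0 \<le> ?V x" by (simp add: gradient_sq_def sum_nonneg sq_diff1_nonneg)
  have step: "(\<integral>y. (max 0 (?V x - ?V (x(i := y))))\<^sup>2 \<partial>M i)
      \<le> 8 * (?V x * (\<Sum>j\<in>I - {i}. 2 * sq_diff2 i j f x) + sq_diff1 i f x * B2\<^sup>2)" if i: "i \<in> I" for i
  proof -
    interpret Mi: prob_space "M i" using i by (rule prob_factor)
    have D0: "bdd_measurable (M i) (\<lambda>y. \<integral>z. (f x - f (x(i := y)) - f (x(j := z)) + f (x(i := y, j := z)))\<^sup>2 \<partial>M j)"
      if j: "j \<in> I - {i}" for j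
      using i j x
      by (intro bm_intros bdd_measurable_integral prob_factor update_measurable
          bdd_measurable_update[OF f] bdd_measurable_compose[OF f]) auto
    have D: "bdd_measurable (M i) (?D i j)" if j: "j \<in> I - {i}" for j
      by (intro bm_intros D0 j)
    define S where "S = (\<lambda>y. \<Sum>j\<in>I - {i}. ?D i j y)"
    have S: "bdd_measurable (M i) S"
      unfolding S_def by (intro bdd_measurable_sum D)
    have "(\<integral>y. (max 0 (?V x - ?V (x(i := y))))\<^sup>2 \<partial>M i)
        \<le> (\<integral>y. 8 * (?V x * S y + sq_diff1 i f x * B2\<^sup>2) \<partial>M i)"
    proof (intro Mi.expectation_mono_bdd bm_intros S bdd_measurable_section[OF V i x])
      fix y assume y: "y \<in> space (M i)"
      have "(max 0 (?V x - ?V (x(i := y))))\<^sup>2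
          \<le> 8 * (?V x * S y + (sqrt (sq_diff1 i f x))\<^sup>2 * B2\<^sup>2)"
        unfolding V_root S_def
        by (intro sum_of_squares_difference finite_index i B2 sq_diff1_root_difference f x y
            real_sqrt_ge_zero sq_diff1_nonneg) auto
      then show "(max 0 (?V x - ?V (x(i := y))))\<^sup>2
          \<le> 8 * (?V x * S y + sq_diff1 i f x * B2\<^sup>2)"
        by (simp add: sq_diff1_nonneg)
    qed
    also have "\<dots> = 8 * (?V x * (\<integral>y. S y \<partial>M i) + sq_diff1 i f x * B2\<^sup>2)"
      by (simp add: Mi.integrable_bdd_measurable[OF S] Mi.prob_space)
    also have "(\<integral>y. S y \<partial>M i) = (\<Sum>j\<in>I - {i}. (\<integral>y. ?D i j y \<partial>M i))"
      unfolding S_def by (intro Bochner_Integration.integral_sum Mi.integrable_bdd_measurable D)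
    also have "\<dots> = (\<Sum>j\<in>I - {i}. 2 * sq_diff2 i j f x)"
      by (simp add: sq_diff2_def)
    finally show ?thesis .
  qed
  have "(\<Sum>i\<in>I. \<integral>y. (max 0 (?V x - ?V (x(i := y))))\<^sup>2 \<partial>M i)
      \<le> (\<Sum>i\<in>I. 8 * (?V x * (\<Sum>j\<in>I - {i}. 2 * sq_diff2 i j f x) + sq_diff1 i f x * B2\<^sup>2))"
    by (intro sum_mono step)
  also have "\<dots> = 8 * (?V x * (2 * (\<Sum>i\<in>I. \<Sum>j\<in>I - {i}. sq_diff2 i j f x)) + ?V x * B2\<^sup>2)"
    by (simp add: gradient_sq_def sum.distrib sum_distrib_left sum_distrib_right)
  also have "\<dots> \<le> 8 * (?V x * (2 * B1\<^sup>2) + ?V x * B2\<^sup>2)"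
    using B1 V0 by (intro mult_left_mono add_right_mono) auto
  also have "\<dots> = 8 * ?V x * (2 * B1\<^sup>2 + B2\<^sup>2)" by (simp add: algebra_simps)
  also have "\<dots> \<le> 8 * ?V x * (2 * (B1 + B2)\<^sup>2)"
    using V0 B by (intro mult_left_mono) (auto simp: power2_sum)
  finally show ?thesis by (simp add: algebra_simps)
qed

text \<open>
  The last two hypotheses express that the terms of degree 0 and 1 in the Hoeffding decomposition vanish:
  \<open>f\<close> is centred and orthogonal to every function of a single coordinate.
\<close>

theorem second_order_concentration:
  assumes f: "bm f" and B: "0 \<le> B1" "0 \<le> B2" "0 < B1 + B2"
    and B1: "\<And>x. x \<in> space (Pi\<^sub>M I M) \<Longrightarrow> (\<Sum>i\<in>I. \<Sum>j\<in>I - {i}. sq_diff2 i j f x) \<le> B1\<^sup>2"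
    and B2: "\<And>x i. x \<in> space (Pi\<^sub>M I M) \<Longrightarrow> i \<in> I \<Longrightarrow> sqrt (sq_diff1 i f x) \<le> B2"
    and mean: "expectation f = 0"
    and orth: "\<And>j h. j \<in> I \<Longrightarrow> bm h \<Longrightarrow> (\<And>i. i \<in> I - {j} \<Longrightarrow> ignores h i) \<Longrightarrow> expectation (\<lambda>x. f x * h x) = 0"
  shows "expectation (\<lambda>x. exp (\<bar>f x\<bar> / (7 * (B1 + B2)))) \<le> 2"
proof -
  define \<sigma> where "\<sigma> = B1 + B2"
  have \<sigma>: "0 < \<sigma>" "B1\<^sup>2 \<le> \<sigma>\<^sup>2" using B by (auto simp: \<sigma>_def)
  define W where "W = (\<lambda>x. gradient_sq f x / \<sigma>\<^sup>2)"
  have W: "bm W" unfolding W_def by (intro bm_intros bm_gradient_sq f)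
  have "expectation (gradient_sq f) = (\<Sum>j\<in>I. expectation (sq_diff1 j f))"
    unfolding gradient_sq_def
    by (intro Bochner_Integration.integral_sum integrable_bdd_measurable bm_intros f)
  also have "\<dots> \<le> (\<Sum>j\<in>I. \<Sum>i\<in>I - {j}. expectation (sq_diff2 i j f))"
    by (intro sum_mono second_order_Efron_Stein f orth)
  also have "\<dots> = (\<Sum>i\<in>I. \<Sum>j\<in>I - {i}. expectation (sq_diff2 i j f))"
  proof -
    have "(\<Sum>j\<in>I. \<Sum>i\<in>I - {j}. expectation (sq_diff2 i j f))
        = (\<Sum>j\<in>I. \<Sum>i | i \<in> I \<and> i \<noteq> j. expectation (sq_diff2 i j f))"
      by (intro sum.cong) auto
    also have "\<dots> = (\<Sum>i\<in>I. \<Sum>j | j \<in> I \<and> i \<noteq> j. expectation (sq_diff2 i j f))"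
      by (rule sum.swap_restrict[OF finite_index finite_index])
    also have "\<dots> = (\<Sum>i\<in>I. \<Sum>j\<in>I - {i}. expectation (sq_diff2 i j f))"
      by (intro sum.cong) auto
    finally show ?thesis .
  qed
  also have "\<dots> = (\<Sum>i\<in>I. expectation (\<lambda>x. \<Sum>j\<in>I - {i}. sq_diff2 i j f x))"
    by (intro sum.cong refl Bochner_Integration.integral_sum[symmetric] integrable_bdd_measurable
        bm_sq_diff2 f) auto
  also have "\<dots> = expectation (\<lambda>x. \<Sum>i\<in>I. \<Sum>j\<in>I - {i}. sq_diff2 i j f x)"
    by (intro Bochner_Integration.integral_sum[symmetric] integrable_bdd_measurable
        bdd_measurable_sum bm_sq_diff2 f) auto
  also have "\<dots> \<le> expectation (\<lambda>x. B1\<^sup>2)"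
    by (intro expectation_mono_bdd bm_intros bm_sq_diff2 f B1) auto
  also have "\<dots> \<le> \<sigma>\<^sup>2" using \<sigma> by (simp add: prob_space)
  finally have meanW: "expectation W \<le> 1" using \<sigma> by (simp add: W_def)
  have entW: "exp_entropy (\<lambda>x. s * W x) \<le> 16 * s\<^sup>2 * expectation (\<lambda>x. exp (s * W x) * W x)" if s: "0 < s" for s
  proof -
    let ?c = "\<lambda>t::real. (max 0 t)\<^sup>2"
    have bs: "bm (\<lambda>x. s * W x)" by (intro bm_intros W)
    have "exp_entropy (\<lambda>x. s * W x)
        \<le> expectation (\<lambda>x. exp (s * W x) * (\<Sum>i\<in>I. \<integral>y. ?c (s * W x - s * W (x(i := y))) \<partial>M i))"
      by (intro modified_log_Sobolev bs exp_difference_one_sided continuous_intros)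
    also have "\<dots> \<le> expectation (\<lambda>x. exp (s * W x) * (16 * s\<^sup>2 * W x))"
    proof (intro expectation_mono_bdd)
      show "bm (\<lambda>x. exp (s * W x) * (\<Sum>i\<in>I. \<integral>y. ?c (s * W x - s * W (x(i := y))) \<partial>M i))"
        by (intro bm_intros W bdd_measurable_integral prob_factor bdd_measurable_update[OF W]
            bdd_measurable_compose[OF W]) auto
      show "bm (\<lambda>x. exp (s * W x) * (16 * s\<^sup>2 * W x))" by (intro bm_intros W)
      fix x assume x: "x \<in> space (Pi\<^sub>M I M)"
      have scale: "?c (s * W x - s * W x') = (s / \<sigma>\<^sup>2)\<^sup>2 * ?c (gradient_sq f x - gradient_sq f x')" for x'
      proof -
        have "max 0 (s * W x - s * W x') = s / \<sigma>\<^sup>2 * max 0 (gradient_sq f x - gradient_sq f x')"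
          using s \<sigma> by (simp add: W_def max_mult_distrib_left right_diff_distrib)
        then show ?thesis by (simp only: power_mult_distrib)
      qed
      have "(\<Sum>i\<in>I. \<integral>y. ?c (s * W x - s * W (x(i := y))) \<partial>M i)
          = (s / \<sigma>\<^sup>2)\<^sup>2 * (\<Sum>i\<in>I. \<integral>y. ?c (gradient_sq f x - gradient_sq f (x(i := y))) \<partial>M i)"
        unfolding scale by (simp add: sum_distrib_left)
      also have "\<dots> \<le> (s / \<sigma>\<^sup>2)\<^sup>2 * (16 * \<sigma>\<^sup>2 * gradient_sq f x)"
        unfolding \<sigma>_def by (intro mult_left_mono gradient_sq_self_bounding f x B B1 B2) auto
      also have "\<dots> = 16 * s\<^sup>2 * W x"
        using \<sigma> by (simp add: W_def power2_eq_square field_simps)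
      finally show "exp (s * W x) * (\<Sum>i\<in>I. \<integral>y. ?c (s * W x - s * W (x(i := y))) \<partial>M i)
          \<le> exp (s * W x) * (16 * s\<^sup>2 * W x)"
        by (intro mult_left_mono) auto
    qed
    also have "\<dots> = 16 * s\<^sup>2 * expectation (\<lambda>x. exp (s * W x) * W x)"
      by (subst integral_mult_right_zero[symmetric]) (simp only: mult_ac)
    finally show ?thesis .
  qed
  \<comment> \<open>The sign \<open>\<epsilon>\<close> treats \<open>f\<close> and \<open>-f\<close>, which have the same squared gradient, at once.\<close>
  have mgf: "expectation (\<lambda>x. exp (\<epsilon> * f x / \<sigma> / 5)) \<le> exp (1 / 5)" if \<epsilon>: "\<epsilon>\<^sup>2 = 1" for \<epsilon>
  proof (rule mgf_second_order[of "\<lambda>x. \<epsilon> * f x / \<sigma>", OF _ W])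
    show "bm (\<lambda>x. \<epsilon> * f x / \<sigma>)" by (intro bm_intros f)
    show "expectation (\<lambda>x. \<epsilon> * f x / \<sigma>) = 0" using mean by simp
    show "ln (expectation (\<lambda>x. exp (t * W x))) \<le> t / (1 - 16 * t)" if "0 < t" "t < 1 / 16" for t
      using W meanW that entW by (rule mgf_self_bounding)
    fix s :: real assume s: "0 < s"
    let ?F = "\<lambda>x. s * (\<epsilon> * f x / \<sigma>)"
    let ?c = "\<lambda>t::real. t\<^sup>2 / 2"
    have bs: "bm ?F" by (intro bm_intros f)
    have "exp_entropy ?F
        \<le> expectation (\<lambda>x. exp (?F x) * (\<Sum>i\<in>I. \<integral>y. ?c (?F x - ?F (x(i := y))) \<partial>M i))"
      by (rule modified_log_Sobolev[OF bs _ exp_difference_quadratic]) (intro continuous_intros, simp)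
    also have "\<dots> = expectation (\<lambda>x. exp (?F x) * (s\<^sup>2 * W x))"
    proof -
      have scale: "?c (?F x - ?F x') = s\<^sup>2 / \<sigma>\<^sup>2 * (1/2 * (f x - f x')\<^sup>2)" for x x'
      proof -
        have "?F x - ?F x' = \<epsilon> * (s / \<sigma> * (f x - f x'))" by (simp add: algebra_simps diff_divide_distrib)
        then show ?thesis by (simp only: power_mult_distrib \<epsilon> power_divide)
      qed
      have "(\<Sum>i\<in>I. \<integral>y. ?c (?F x - ?F (x(i := y))) \<partial>M i) = s\<^sup>2 * W x" for x
        unfolding scale W_def gradient_sq_def sq_diff1_def
        by (simp add: sum_distrib_left sum_divide_distrib mult_ac)
      then show ?thesis by simp
    qed
    also have "\<dots> = s\<^sup>2 * expectation (\<lambda>x. exp (?F x) * W x)"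
      by (subst integral_mult_right_zero[symmetric]) (simp only: mult_ac)
    finally show "exp_entropy ?F \<le> s\<^sup>2 * expectation (\<lambda>x. exp (?F x) * W x)" .
  qed
  have "expectation (\<lambda>x. exp (\<bar>f x / \<sigma>\<bar> / 7)) \<le> 2"
    using mgf[of 1] mgf[of "-1"] by (intro exp_abs_moment_le_2 bm_intros f) auto
  then show ?thesis using \<sigma> by (simp add: \<sigma>_def mult.commute)
qed

end

context finite_probability_product
begin

section \<open>The Hoeffding decomposition\<close>

lemma distr_restrict_subproduct:
  assumes "J \<subseteq> K" "K \<subseteq> I"
  shows "distr (Pi\<^sub>M K M) (Pi\<^sub>M J M) (\<lambda>x. restrict x J) = Pi\<^sub>M J M"
  using distr_PiM_reindex[of K M id J] assms prob_factor by (auto simp: restrict_def subset_iff)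

lemma integrable_kernel_mult:
  fixes k :: "('i \<Rightarrow> 'a) \<Rightarrow> real"
  assumes K: "K \<subseteq> I" and k: "integrable (Pi\<^sub>M K M) k" and h: "bm h"
  shows "integrable (Pi\<^sub>M I M) (\<lambda>x. k (restrict x K) * h x)"
proof -
  obtain C where C: "0 < C" "\<And>x. x \<in> space (Pi\<^sub>M I M) \<Longrightarrow> \<bar>h x\<bar> \<le> C"
    using bdd_measurable_bound[OF h] by blast
  have r: "(\<lambda>x. restrict x K) \<in> measurable (Pi\<^sub>M I M) (Pi\<^sub>M K M)"
    by (rule measurable_restrict_subset[OF K])
  have "integrable (distr (Pi\<^sub>M I M) (Pi\<^sub>M K M) (\<lambda>x. restrict x K)) k"
    using k K by (simp add: distr_restrict_subproduct)
  then have i: "integrable (Pi\<^sub>M I M) (\<lambda>x. k (restrict x K))"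
    using r by (rule integrable_distr[rotated])
  have [measurable]: "h \<in> borel_measurable (Pi\<^sub>M I M)" "(\<lambda>x. k (restrict x K)) \<in> borel_measurable (Pi\<^sub>M I M)"
    using h i by (auto intro: bdd_measurable_borel)
  show ?thesis
  proof (rule Bochner_Integration.integrable_bound)
    show "integrable (Pi\<^sub>M I M) (\<lambda>x. C * \<bar>k (restrict x K)\<bar>)" using i by simp
    show "AE x in Pi\<^sub>M I M. norm (k (restrict x K) * h x) \<le> norm (C * \<bar>k (restrict x K)\<bar>)"
    proof (rule AE_I2)
      fix x assume "x \<in> space (Pi\<^sub>M I M)"
      then show "norm (k (restrict x K) * h x) \<le> norm (C * \<bar>k (restrict x K)\<bar>)"
        using C mult_left_mono[OF C(2), of x "\<bar>k (restrict x K)\<bar>"] by (simp add: abs_mult mult.commute)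
    qed
  qed measurable
qed

text \<open>
  Integrate in the \<open>j\<close>-th coordinate first: there \<open>h\<close> is constant and the kernel integrates to 0. The kernel is only
  integrable and the integral vanishes only almost everywhere, so this step is carried out
  on \<open>I - {j}\<close> and not with \<open>average\<close>.
\<close>

lemma canonical_kernel_orthogonal:
  fixes k :: "('i \<Rightarrow> 'a) \<Rightarrow> real"
  assumes K: "K \<subseteq> I" and j: "j \<in> K" and k: "integrable (Pi\<^sub>M K M) k"
    and canonical: "AE x in Pi\<^sub>M (K - {j}) M. (\<integral>y. k (x(j := y)) \<partial>M j) = 0"
    and h: "bm h" "ignores h j"
  shows "expectation (\<lambda>x. k (restrict x K) * h x) = 0"
proof -
  have jI: "j \<in> I" using j K by auto
  interpret Mj: prob_space "M j" using jI by (rule prob_factor)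
  obtain y0 where y0: "y0 \<in> space (M j)" using Mj.not_empty by blast
  have "AE x in distr (Pi\<^sub>M (I - {j}) M) (Pi\<^sub>M (K - {j}) M) (\<lambda>x. restrict x (K - {j})).
      (\<integral>y. k (x(j := y)) \<partial>M j) = 0"
    using canonical K by (subst distr_restrict_subproduct) auto
  then have zero: "AE x in Pi\<^sub>M (I - {j}) M. (\<integral>y. k ((restrict x (K - {j}))(j := y)) \<partial>M j) = 0"
    by (rule AE_distrD[rotated]) (use K in \<open>auto intro!: measurable_restrict_subset\<close>)
  have "expectation (\<lambda>x. k (restrict x K) * h x)
      = (\<integral>x. (\<integral>y. k (restrict (x(j := y)) K) * h (x(j := y)) \<partial>M j) \<partial>Pi\<^sub>M (I - {j}) M)"
    by (rule integral_section[OF jI integrable_kernel_mult[OF K k h(1)]])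
  also have "\<dots> = 0"
  proof (rule integral_eq_zero_AE)
    show "AE x in Pi\<^sub>M (I - {j}) M. (\<integral>y. k (restrict (x(j := y)) K) * h (x(j := y)) \<partial>M j) = 0"
      using zero AE_space
    proof eventually_elim
      case (elim x)
      have x: "x(j := y0) \<in> space (Pi\<^sub>M I M)"
        using elim(2) y0 jI by (auto simp: space_PiM PiE_iff extensional_def)
      have "(\<integral>y. k (restrict (x(j := y)) K) * h (x(j := y)) \<partial>M j)
          = (\<integral>y. k ((restrict x (K - {j}))(j := y)) * h (x(j := y0)) \<partial>M j)"
      proof (rule Bochner_Integration.integral_cong[OF refl])
        fix y assume y: "y \<in> space (M j)"
        have "restrict (x(j := y)) K = (restrict x (K - {j}))(j := y)"
          using j by (auto simp: fun_eq_iff)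
        moreover have "h (x(j := y)) = h (x(j := y0))"
          using ignoresD[OF h(2) x y] by simp
        ultimately show "k (restrict (x(j := y)) K) * h (x(j := y))
            = k ((restrict x (K - {j}))(j := y)) * h (x(j := y0))" by simp
      qed
      then show ?case using elim(1) by simp
    qed
  qed
  finally show ?thesis .
qed

end

text \<open>
  A kernel of degree at least 2 depends on a coordinate other than \<open>j\<close> in which it integrates to 0.
\<close>

lemma hoeffding_degree_two_orthogonal:
  assumes P: "finite_probability_product {1..n} M"
    and meas: "f \<in> borel_measurable (Pi\<^sub>M {1..n} M)"
    and dec: "hoeffding_decomposition n M f h"
    and low: "AE x in Pi\<^sub>M {1..n} M. hoeffding_term n h 0 x = 0" "AE x in Pi\<^sub>M {1..n} M. hoeffding_term n h 1 x = 0"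
    and \<phi>: "bdd_measurable (Pi\<^sub>M {1..n} M) \<phi>"
    and ign: "\<And>i. i \<in> {1..n} - {j} \<Longrightarrow> finite_probability_product.ignores {1..n} M \<phi> i"
  shows "(\<integral>x. f x * \<phi> x \<partial>Pi\<^sub>M {1..n} M) = 0"
proof -
  interpret finite_probability_product "{1..n}" M by (rule P)
  let ?K = "\<lambda>k. {K. K \<subseteq> {1..n} \<and> card K = k}"
  have int: "integrable (Pi\<^sub>M K M) (h K)" if "K \<subseteq> {1..n}" for K
    using dec that by (auto simp: hoeffding_decomposition_def)
  have canon: "AE x in Pi\<^sub>M (K - {i}) M. (\<integral>y. h K (x(i := y)) \<partial>M i) = 0" if "K \<subseteq> {1..n}" "i \<in> K" for K i
    using dec that by (auto simp: hoeffding_decomposition_def)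
  have kernel: "expectation (\<lambda>x. h K (restrict x K) * \<phi> x) = 0" if K: "K \<subseteq> {1..n}" "2 \<le> card K" for K
  proof -
    have "\<not> K \<subseteq> {j}" using K(2) card_mono[of "{j}" K] by auto
    then obtain i where i: "i \<in> K" "i \<noteq> j" by auto
    show ?thesis
      using i K(1) by (intro canonical_kernel_orthogonal[of K i] int canon \<phi> ign) auto
  qed
  have ik: "integrable (Pi\<^sub>M {1..n} M) (\<lambda>x. h K (restrict x K) * \<phi> x)" if "K \<in> ?K k" for K k
    using that by (intro integrable_kernel_mult int \<phi>) auto
  have "AE x in Pi\<^sub>M {1..n} M. f x = (\<Sum>k=0..n. hoeffding_term n h k x)"
    using dec by (simp add: hoeffding_decomposition_def)
  then have "AE x in Pi\<^sub>M {1..n} M. f x * \<phi> x = (\<Sum>k\<in>{2..n}. \<Sum>K\<in>?K k. h K (restrict x K) * \<phi> x)"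
    using low
  proof eventually_elim
    case (elim x)
    have "(\<Sum>k=0..n. hoeffding_term n h k x) = (\<Sum>k\<in>{2..n}. hoeffding_term n h k x)"
    proof (rule sum.mono_neutral_right)
      show "\<forall>k\<in>{0..n} - {2..n}. hoeffding_term n h k x = 0"
      proof
        fix k assume "k \<in> {0..n} - {2..n}"
        then have "k = 0 \<or> k = 1" by auto
        then show "hoeffding_term n h k x = 0" using elim by auto
      qed
    qed auto
    then show ?case
      using elim(1) by (simp add: hoeffding_term_def sum_distrib_right)
  qed
  then have "expectation (\<lambda>x. f x * \<phi> x) = expectation (\<lambda>x. \<Sum>k\<in>{2..n}. \<Sum>K\<in>?K k. h K (restrict x K) * \<phi> x)"
  proof (rule integral_cong_AE[rotated 2])
    show "(\<lambda>x. f x * \<phi> x) \<in> borel_measurable (Pi\<^sub>M {1..n} M)"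
      by (rule borel_measurable_times[OF meas bdd_measurable_borel[OF \<phi>]])
    show "(\<lambda>x. \<Sum>k\<in>{2..n}. \<Sum>K\<in>?K k. h K (restrict x K) * \<phi> x) \<in> borel_measurable (Pi\<^sub>M {1..n} M)"
      by (rule borel_measurable_integrable) (intro Bochner_Integration.integrable_sum ik)
  qed
  also have "\<dots> = (\<Sum>k\<in>{2..n}. expectation (\<lambda>x. \<Sum>K\<in>?K k. h K (restrict x K) * \<phi> x))"
    by (intro Bochner_Integration.integral_sum Bochner_Integration.integrable_sum ik)
  also have "\<dots> = (\<Sum>k\<in>{2..n}. \<Sum>K\<in>?K k. expectation (\<lambda>x. h K (restrict x K) * \<phi> x))"
    by (intro sum.cong refl Bochner_Integration.integral_sum ik)
  also have "\<dots> = 0" by (intro sum.neutral ballI kernel) auto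
  finally show ?thesis .
qed

lemma second_order_exponential_moment:
  assumes H: "second_order_hypotheses n M f B1 B2"
  shows "bdd_measurable (Pi\<^sub>M {1..n} M) f" (is ?bdd)
    and "(\<integral>x. exp ((1/7) / (B1 + B2) * \<bar>f x\<bar>) \<partial>Pi\<^sub>M {1..n} M) \<le> 2" (is ?moment)
proof -
  have n: "1 \<le> n" and prob: "\<And>i. i \<in> {1..n} \<Longrightarrow> prob_space (M i)"
    and meas: "f \<in> borel_measurable (Pi\<^sub>M {1..n} M)"
    and bdd: "bounded (f ` space (Pi\<^sub>M {1..n} M))" and B: "0 \<le> B1" "0 \<le> B2"
    and B1: "\<And>x. x \<in> space (Pi\<^sub>M {1..n} M) \<Longrightarrow> hs_norm n (diff2_matrix M f x) \<le> B1"
    and B2: "\<And>x. x \<in> space (Pi\<^sub>M {1..n} M) \<Longrightarrow> (MAX i\<in>{1..n}. \<bar>diff1 M f i x\<bar>) \<le> B2"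
    using H unfolding second_order_hypotheses_def by auto
  obtain h where h: "hoeffding_decomposition n M f h"
    "AE x in Pi\<^sub>M {1..n} M. hoeffding_term n h 0 x = 0" "AE x in Pi\<^sub>M {1..n} M. hoeffding_term n h 1 x = 0"
    using H unfolding second_order_hypotheses_def by blast
  have P: "finite_probability_product {1..n} M"
    by (rule finite_probability_product.intro[OF finite_atLeastAtMost prob])
  interpret finite_probability_product "{1..n}" M by (rule P)
  have f: "bm f"
    using meas bdd unfolding bdd_measurable_def bounded_iff by auto
  then show ?bdd .
  note orth = hoeffding_degree_two_orthogonal[OF P meas h]
  \<comment> \<open>Constants are functions of the first coordinate, which exists as \<open>n \<ge> 1\<close>.\<close>
  have "expectation (\<lambda>x. f x * 1) = 0"
    by (rule orth[of "\<lambda>_. 1" 1]) (intro bm_intros, simp only: ignores_def, simp)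
  then have mean: "expectation f = 0" by simp
  have sq1: "diff1 M f i x = sqrt (sq_diff1 i f x)" for i x
    by (simp add: diff1_def sq_diff1_def)
  have sq2: "(diff2 M f i j x)\<^sup>2 = sq_diff2 i j f x" for i j x
    using sq_diff2_nonneg[of i j f x] by (simp add: diff2_def sq_diff2_def)
  have B1': "(\<Sum>i\<in>{1..n}. \<Sum>j\<in>{1..n} - {i}. sq_diff2 i j f x) \<le> B1\<^sup>2" if x: "x \<in> space (Pi\<^sub>M {1..n} M)" for x
  proof -
    have "(\<Sum>j\<in>{1..n}. \<bar>diff2_matrix M f x i j\<bar>\<^sup>2) = (\<Sum>j\<in>{1..n} - {i}. sq_diff2 i j f x)" for i
      by (rule sum.mono_neutral_cong_right) (auto simp: diff2_matrix_def sq2)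
    then have "hs_norm n (diff2_matrix M f x) = sqrt (\<Sum>i\<in>{1..n}. \<Sum>j\<in>{1..n} - {i}. sq_diff2 i j f x)"
      by (simp add: hs_norm_def)
    then show ?thesis using B1[OF x] by (simp add: sqrt_le_D)
  qed
  have B2': "sqrt (sq_diff1 i f x) \<le> B2" if "x \<in> space (Pi\<^sub>M {1..n} M)" "i \<in> {1..n}" for x i
  proof -
    have "\<bar>diff1 M f i x\<bar> \<le> (MAX i\<in>{1..n}. \<bar>diff1 M f i x\<bar>)"
      using that(2) by (intro Max_ge) auto
    then show ?thesis using B2[OF that(1)] by (simp add: sq1 sq_diff1_nonneg)
  qed
  show ?moment
  \<comment> \<open>If \<open>B1 + B2 = 0\<close>, the quotient is 0 by convention and the integrand is 1.\<close>
  proof (cases "B1 + B2 = 0")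
    case True
    then show ?thesis using prob_space by simp
  next
    case False
    then have "0 < B1 + B2" using B by simp
    then have "expectation (\<lambda>x. exp (\<bar>f x\<bar> / (7 * (B1 + B2)))) \<le> 2"
      by (intro second_order_concentration f B B1' B2' mean orth) auto
    then show ?thesis by (simp add: mult.commute)
  qed
qed

theorem theorem6p1:
  shows
    "(\<exists>c::real>0. \<forall>n (M :: nat \<Rightarrow> 'a measure) f B1 B2.
        second_order_hypotheses n M f B1 B2 \<longrightarrow>
          (\<integral>x. exp (c / (B1 + B2) * \<bar>f x\<bar>) \<partial>Pi\<^sub>M {1..n} M) \<le> 2) \<and>
     (\<forall>n (M :: nat \<Rightarrow> 'a measure) f B1 B2.
        second_order_hypotheses n M f B1 B2 \<longrightarrow>
          (\<integral>x. exp ((1/11) / (B1 + B2) * \<bar>f x\<bar>) \<partial>Pi\<^sub>M {1..n} M) \<le> 2) \<and>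
     (\<forall>n (M :: nat \<Rightarrow> 'a measure) f B1 B2.
        second_order_hypotheses n M f B1 B2 \<and> (\<forall>i\<in>{1..n}. two_point_measure (M i)) \<longrightarrow>
          (\<integral>x. exp ((1/7) / (B1 + B2) * \<bar>f x\<bar>) \<partial>Pi\<^sub>M {1..n} M) \<le> 2)"
proof -
  have eleven: "(\<integral>x. exp ((1/11) / (B1 + B2) * \<bar>f x\<bar>) \<partial>Pi\<^sub>M {1..n} M) \<le> 2"
    if H: "second_order_hypotheses n M f B1 B2" for n and M :: "nat \<Rightarrow> 'a measure" and f B1 B2
  proof -
    have B: "0 \<le> B1" "0 \<le> B2" and prob: "\<And>i. i \<in> {1..n} \<Longrightarrow> prob_space (M i)"
      using H unfolding second_order_hypotheses_def by auto
    interpret prob_space "Pi\<^sub>M {1..n} M" by (rule prob_space_PiM) (rule prob)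
    note f = second_order_exponential_moment(1)[OF H]
    have "expectation (\<lambda>x. exp ((1/11) / (B1 + B2) * \<bar>f x\<bar>)) \<le> expectation (\<lambda>x. exp ((1/7) / (B1 + B2) * \<bar>f x\<bar>))"
    proof (intro expectation_mono_bdd bm_intros f)
      fix x
      show "exp ((1/11) / (B1 + B2) * \<bar>f x\<bar>) \<le> exp ((1/7) / (B1 + B2) * \<bar>f x\<bar>)"
        unfolding exp_le_cancel_iff using B by (intro mult_right_mono divide_right_mono) auto
    qed
    also have "\<dots> \<le> 2" by (rule second_order_exponential_moment(2)[OF H])
    finally show ?thesis .
  qed
  show ?thesis
    using eleven second_order_exponential_moment(2) by (intro conjI exI[of _ "1/7"]) auto
qed

end
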